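(* Let $n\ge 2$ and let $\Omega=(a_1,b_1)\times\cdots\times(a_n,b_n)\subset\mathbb{R}^n$ be a bounded box. Suppose there are constants $C_1,C_2,C_3>0$ and a function $f:\Omega\times[0,\infty)\to[0,\infty)$ such that (i) $f(x,s)\ge \lambda s-C_1$ for all $x\in\Omega$, $s\ge 0$, for some $\lambda>\lambda_1:=\sum_{i=1}^n\frac{\pi^2}{(b_i-a_i)^2}$; (ii) $f(x,s)\le C_2 s^p+C_3$ for all $x\in\Omega$, $s\ge0$, for some $p\in(1,\frac{n}{n-1})$. Then there exists a constant $\overline{M}$, independent of the mesh size vector $h$, such that for every admissible $h$ every non-negative solution $u:\overline{\Omega}_h\to[0,\infty)$ of $$-\Delta_h u(x)=f(x,u(x))\ \ (x\in\Omega_h),\qquad u=0\ \text{on }\partial\Omega_h$$ satisfies $\|u\|_\infty=\max_{x\in\overline{\Omega}_h}|u(x)|\le\overline{M}$.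
   Context: A mesh size vector $h=(h_1,\dots,h_n)$, $h_i>0$, is admissible for the box if $a_i=k_ih_i$, $b_i=l_ih_i$ with $k_i,l_i\in\mathbb{Z}$, $l_i-k_i>1$. Let $\mathbb{R}^n_h=\{(h_1z_1,\dots,h_nz_n):z_i\in\mathbb{Z}\}$, $\overline{\Omega}_h=\overline{\Omega}\cap\mathbb{R}^n_h$, $\Omega_h=\Omega\cap\mathbb{R}^n_h$, $\partial\Omega_h=\partial\Omega\cap\mathbb{R}^n_h$. With $\delta_i=h_ie_i$ ($e_i$ the standard basis vectors), the discrete Laplacian is $\Delta_hu(x)=\sum_{i=1}^n\frac{u(x+\delta_i)-2u(x)+u(x-\delta_i)}{h_i^2}$ for $x\in\Omega_h$. *)

theory Defs
  imports "HOL-Analysis.Analysis"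
begin

definition admissible_mesh :: "real^'n \<Rightarrow> real^'n \<Rightarrow> real^'n \<Rightarrow> bool" where
  "admissible_mesh a b h \<longleftrightarrow> (\<forall>i. h$i > 0 \<and>
     (\<exists>k l :: int. a$i = of_int k * h$i \<and> b$i = of_int l * h$i \<and> l - k > 1))"

definition lattice :: "real^'n \<Rightarrow> (real^'n) set" where
  "lattice h = {x. \<forall>i. \<exists>z::int. x$i = h$i * of_int z}"

definition grid_closed :: "real^'n \<Rightarrow> real^'n \<Rightarrow> real^'n \<Rightarrow> (real^'n) set" where
  "grid_closed a b h = cbox a b \<inter> lattice h"

definition grid_interior :: "real^'n \<Rightarrow> real^'n \<Rightarrow> real^'n \<Rightarrow> (real^'n) set" where
  "grid_interior a b h = box a b \<inter> lattice h"

definition grid_boundary :: "real^'n \<Rightarrow> real^'n \<Rightarrow> real^'n \<Rightarrow> (real^'n) set" where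
  "grid_boundary a b h = (cbox a b - box a b) \<inter> lattice h"

definition discrete_laplacian :: "real^'n \<Rightarrow> (real^'n \<Rightarrow> real) \<Rightarrow> real^'n \<Rightarrow> real" where
  "discrete_laplacian h u x =
     (\<Sum>i\<in>UNIV. (u (x + (h$i) *\<^sub>R axis i 1) - 2 * u x + u (x - (h$i) *\<^sub>R axis i 1)) / (h$i)^2)"

definition lambda1 :: "real^'n \<Rightarrow> real^'n \<Rightarrow> real" where
  "lambda1 a b = (\<Sum>i\<in>UNIV. pi^2 / (b$i - a$i)^2)"

end

theory Submission
  imports Defs
begin

text \<open>On a box the first eigenfunction \<open>\<phi>\<close> is a product of sines \<open>s\<^sub>i\<close>, and testing the equation with
  \<open>\<phi>\<close> bounds \<open>\<integral> f \<phi>\<close>. If \<open>v\<close> vanishes on the boundary, then \<open>v\<^sup>2 \<le> C s\<^sub>i \<integral> \<bar>\<partial>\<^sub>i v\<bar>\<^sup>2\<close> along every line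
  in direction \<open>i\<close>, and Loomis-Whitney turns these \<open>n\<close> estimates into a bound of
  \<open>\<integral> (v\<^sup>2\<^sup>n / \<phi>)\<^sup>r\<close>, \<open>r = 1/(n-1)\<close>, by a power of the Dirichlet energy. Applied to a truncated
  power of the Green function \<open>G\<close>, this gives an almost critical weighted bound on \<open>G\<close> that depends
  neither on the pole nor on the mesh. With \<open>M = max u\<close>, \<open>f \<le> C M\<^sup>p + C\<close> and the bound on
  \<open>\<integral> f \<phi>\<close>, the representation \<open>M = \<integral> G f\<close> yields \<open>M \<le> C + C M\<^sup>\<beta>\<close>, where \<open>\<beta>\<close> is slightly larger
  than \<open>p (n-1)/n\<close>, hence smaller than \<open>1\<close>.\<close>

section \<open>Slabs and the Loomis-Whitney inequality\<close>

definition upd :: "'a^'n::finite \<Rightarrow> 'n \<Rightarrow> 'a \<Rightarrow> 'a^'n" where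
  "upd z i t = (\<chi> j. if j = i then t else z$j)"

text \<open>\<open>S\<close> is the set of free directions; the others are frozen at
  \<open>z\<close>. Keeping \<open>S\<close> variable allows induction over the directions.
  \<open>UNIV\<close> gives the whole product set, and \<open>UNIV - {i}\<close> indexes the lines
  in direction \<open>i\<close>.\<close>

definition slab :: "('n::finite \<Rightarrow> 'a set) \<Rightarrow> 'n set \<Rightarrow> 'a^'n \<Rightarrow> ('a^'n) set" where
  "slab A S z = {y. \<forall>i. if i \<in> S then y$i \<in> A i else y$i = z$i}"

lemma upd_nth [simp]: "upd z i t $ j = (if j = i then t else z$j)"
  by (simp add: upd_def)

lemma upd_upd [simp]: "upd (upd z i s) i t = upd z i t"
  by (simp add: vec_eq_iff)

lemma upd_self [simp]: "upd z i (z$i) = z"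
  by (simp add: vec_eq_iff)

lemma slab_empty [simp]: "slab A {} z = {z}"
  by (auto simp: slab_def vec_eq_iff)

lemma slab_insert:
  fixes z :: "'a^'n::finite"
  assumes "i \<notin> S"
  shows "slab A (insert i S) z = (\<Union>t\<in>A i. slab A S (upd z i t))"
proof (rule set_eqI)
  fix y :: "'a^'n"
  show "y \<in> slab A (insert i S) z \<longleftrightarrow> y \<in> (\<Union>t\<in>A i. slab A S (upd z i t))"
  proof
    assume "y \<in> slab A (insert i S) z"
    then have *: "\<And>j. if j \<in> insert i S then y$j \<in> A j else y$j = z$j"
      by (simp add: slab_def)
    have "y \<in> slab A S (upd z i (y$i))"
      unfolding slab_def mem_Collect_eq
    proof
      fix j show "if j \<in> S then y $ j \<in> A j else y $ j = upd z i (y $ i) $ j"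
        using *[of j] by (auto split: if_splits)
    qed
    moreover have "y$i \<in> A i" using *[of i] by simp
    ultimately show "y \<in> (\<Union>t\<in>A i. slab A S (upd z i t))" by blast
  next
    assume "y \<in> (\<Union>t\<in>A i. slab A S (upd z i t))"
    then obtain t where t: "t \<in> A i" and
      *: "\<And>j. if j \<in> S then y$j \<in> A j else y$j = upd z i t $ j"
      by (auto simp: slab_def)
    show "y \<in> slab A (insert i S) z"
      unfolding slab_def mem_Collect_eq
    proof
      fix j show "if j \<in> insert i S then y $ j \<in> A j else y $ j = z $ j"
        using *[of j] t assms by (auto split: if_splits)
    qed
  qed
qed

lemma finite_slab [simp]:
  fixes S :: "'n::finite set"
  assumes "\<And>i. finite (A i)"
  shows "finite (slab A S z)"
proof -
  have "finite S" by simp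
  then show ?thesis
    by (induction S arbitrary: z) (simp_all add: slab_insert assms)
qed

lemma sum_slab_insert:
  fixes F :: "'a^'n::finite \<Rightarrow> 'b::comm_monoid_add"
  assumes "\<And>i. finite (A i)" "i \<notin> S"
  shows "sum F (slab A (insert i S) z) = (\<Sum>t\<in>A i. sum F (slab A S (upd z i t)))"
  unfolding slab_insert[OF assms(2)]
proof (rule sum.UNION_disjoint)
  show "\<forall>t\<in>A i. \<forall>t'\<in>A i. t \<noteq> t' \<longrightarrow> slab A S (upd z i t) \<inter> slab A S (upd z i t') = {}"
  proof (intro ballI impI)
    fix t t' :: 'a assume "t \<noteq> t'"
    moreover have "y$i = s" if "y \<in> slab A S (upd z i s)" for y and s :: 'a
      using that assms(2) by (auto simp: slab_def dest: spec[of _ i])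
    ultimately show "slab A S (upd z i t) \<inter> slab A S (upd z i t') = {}" by blast
  qed
qed (use assms in auto)

lemma sum_slab_upd:
  fixes F :: "'a^'n::finite \<Rightarrow> 'b::comm_monoid_add"
  assumes "i \<notin> S"
  shows "sum F (slab A S (upd z i t)) = (\<Sum>y\<in>slab A S z. F (upd y i t))"
proof (rule sum.reindex_bij_witness[where i="\<lambda>y. upd y i t" and j="\<lambda>y. upd y i (z$i)"])
  fix y assume "y \<in> slab A S (upd z i t)"
  then have *: "if j \<in> S then y$j \<in> A j else y$j = upd z i t $ j" for j
    by (simp add: slab_def)
  then have "y$i = t" using assms by (metis upd_nth)
  then show "upd (upd y i (z $ i)) i t = y"
    and "F (upd (upd y i (z $ i)) i t) = F y"
    by auto
  show "upd y i (z $ i) \<in> slab A S z"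
    unfolding slab_def mem_Collect_eq
  proof
    fix j show "if j \<in> S then upd y i (z $ i) $ j \<in> A j else upd y i (z $ i) $ j = z $ j"
      using *[of j] assms by (auto split: if_splits)
  qed
next
  fix y assume "y \<in> slab A S z"
  then have *: "if j \<in> S then y$j \<in> A j else y$j = z $ j" for j
    by (simp add: slab_def)
  then have "y$i = z$i" using assms by metis
  then show "upd (upd y i t) i (z $ i) = y" by (metis upd_upd upd_self)
  show "upd y i t \<in> slab A S (upd z i t)"
    unfolding slab_def mem_Collect_eq
  proof
    fix j show "if j \<in> S then upd y i t $ j \<in> A j else upd y i t $ j = upd z i t $ j"
      using *[of j] assms by (auto split: if_splits)
  qed
qed

text \<open>Fubini along direction \<open>i\<close>: a line is represented by its point with
  \<open>i\<close>-th coordinate \<open>z$i\<close>, a label that may lie outside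
  \<open>A i\<close>.\<close>

lemma sum_slab_lines:
  fixes F :: "'a^'n::finite \<Rightarrow> 'b::comm_monoid_add"
  assumes "\<And>i. finite (A i)"
  shows "sum F (slab A UNIV z) = (\<Sum>y\<in>slab A (UNIV - {i}) z. \<Sum>t\<in>A i. F (upd y i t))"
proof -
  have "sum F (slab A UNIV z) = sum F (slab A (insert i (UNIV - {i})) z)"
    by (simp add: insert_absorb)
  also have "\<dots> = (\<Sum>t\<in>A i. \<Sum>y\<in>slab A (UNIV - {i}) z. F (upd y i t))"
    by (subst sum_slab_insert[OF assms]) (simp_all add: sum_slab_upd)
  also have "\<dots> = (\<Sum>y\<in>slab A (UNIV - {i}) z. \<Sum>t\<in>A i. F (upd y i t))"
    by (rule sum.swap)
  finally show ?thesis .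
qed

lemma card_slab:
  fixes A :: "'n::finite \<Rightarrow> 'a set"
  assumes "\<And>i. finite (A i)"
  shows "card (slab A S z) = (\<Prod>i\<in>S. card (A i))"
proof -
  have "finite S" by simp
  then have "(\<Sum>x\<in>slab A S z. 1) = (\<Prod>i\<in>S. card (A i))"
    by (induction S arbitrary: z) (simp_all add: sum_slab_insert assms del: sum_constant, simp)
  then show ?thesis by simp
qed

section \<open>Hoelder and Loomis-Whitney inequalities\<close>

lemma prod_powr_le_mean:
  fixes c :: "'i \<Rightarrow> real"
  assumes "finite J" "J \<noteq> {}" "\<And>j. j \<in> J \<Longrightarrow> c j \<ge> 0"
  shows "(\<Prod>j\<in>J. c j powr (1 / real (card J))) \<le> (\<Sum>j\<in>J. c j) / real (card J)"
proof -
  have "(\<Prod>j\<in>J. c j powr (1 / real (card J))) = (\<Prod>j\<in>J. c j) powr (1 / real (card J))"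
    using assms by (simp add: prod_powr_distrib)
  then show ?thesis using arith_geom_mean[OF assms] by (simp add: sum_divide_distrib)
qed

text \<open>Normalising every \<open>c j\<close> to total one turns the left side into a sum of
  geometric means. AM-GM bounds these by arithmetic means, which add up to one.\<close>

lemma Hoelder_sum:
  fixes c :: "'i \<Rightarrow> 't \<Rightarrow> real"
  assumes J: "finite J" "J \<noteq> {}" and T: "finite T"
    and c: "\<And>j t. j \<in> J \<Longrightarrow> t \<in> T \<Longrightarrow> c j t \<ge> 0"
  shows "(\<Sum>t\<in>T. \<Prod>j\<in>J. c j t powr (1 / real (card J)))
           \<le> (\<Prod>j\<in>J. (\<Sum>t\<in>T. c j t) powr (1 / real (card J)))"
proof (cases "\<exists>j\<in>J. (\<Sum>t\<in>T. c j t) = 0")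
  case True
  then obtain j where j: "j \<in> J" "(\<Sum>t\<in>T. c j t) = 0" by blast
  \<comment> \<open>A family with total zero cannot be normalised, but then one factor of every
    product vanishes.\<close>
  then have "c j t = 0" if "t \<in> T" for t
    using that T c sum_nonneg_eq_0_iff[of T "c j"] by auto
  then have "(\<Sum>t\<in>T. \<Prod>j\<in>J. c j t powr (1 / real (card J))) = 0"
    using j(1) J by (intro sum.neutral ballI prod_zero) auto
  then show ?thesis by (simp add: prod_nonneg)
next
  case False
  define s where "s j = (\<Sum>t\<in>T. c j t)" for j
  have s: "s j > 0" if "j \<in> J" for j
    using False that c[OF that] sum_nonneg[of T "c j"] by (force simp: s_def less_le)
  define P where "P = (\<Prod>j\<in>J. s j powr (1 / real (card J)))"
  have cJ: "real (card J) > 0" using J by (simp add: card_gt_0_iff)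
  have "(\<Sum>t\<in>T. \<Prod>j\<in>J. c j t powr (1 / real (card J)))
     = (\<Sum>t\<in>T. P * (\<Prod>j\<in>J. (c j t / s j) powr (1 / real (card J))))"
  proof (rule sum.cong[OF refl])
    fix t assume t: "t \<in> T"
    show "(\<Prod>j\<in>J. c j t powr (1 / real (card J))) = P * (\<Prod>j\<in>J. (c j t / s j) powr (1 / real (card J)))"
      unfolding P_def prod.distrib[symmetric]
    proof (rule prod.cong[OF refl])
      fix j assume j: "j \<in> J"
      show "c j t powr (1 / real (card J)) = s j powr (1 / real (card J)) * (c j t / s j) powr (1 / real (card J))"
        using s[OF j] c[OF j t] by (subst powr_mult[symmetric]) auto
    qed
  qed
  also have "\<dots> \<le> (\<Sum>t\<in>T. P * ((\<Sum>j\<in>J. c j t / s j) / real (card J)))"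
  proof (intro sum_mono mult_left_mono prod_powr_le_mean J)
    fix t j assume "t \<in> T" "j \<in> J"
    then show "0 \<le> c j t / s j" using c s by (simp add: less_imp_le)
  qed (simp add: P_def prod_nonneg)
  also have "\<dots> = P * ((\<Sum>j\<in>J. \<Sum>t\<in>T. c j t / s j) / real (card J))"
    by (simp only: sum_distrib_left[symmetric] sum_divide_distrib[symmetric] sum.swap[of _ J T])
  also have "(\<Sum>j\<in>J. \<Sum>t\<in>T. c j t / s j) = (\<Sum>j\<in>J. 1)"
  proof (intro sum.cong refl)
    fix j assume "j \<in> J"
    then have "s j \<noteq> 0" using s by force
    then show "(\<Sum>t\<in>T. c j t / s j) = 1"
      by (simp add: sum_divide_distrib[symmetric] s_def)
  qed
  finally show ?thesis using cJ by (simp add: P_def s_def)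
qed

text \<open>Induction adds one free direction \<open>i\<close> at a time. The function
  \<open>g i\<close> ignores that coordinate, so its factor leaves the sum over \<open>A i\<close>.
  Hoelder then applies to the other n - 1 factors, whose exponent is exactly 1/(n - 1).\<close>

theorem Loomis_Whitney:
  fixes A :: "'n::finite \<Rightarrow> 'a set" and g :: "'n \<Rightarrow> 'a^'n \<Rightarrow> real"
  assumes A: "\<And>i. finite (A i)" and n: "CARD('n) \<ge> 2"
    and g: "\<And>i x. g i x \<ge> 0" "\<And>i x t. g i (upd x i t) = g i x"
  shows "(\<Sum>x\<in>slab A S z. \<Prod>i\<in>UNIV. g i x powr (1 / (real CARD('n) - 1)))
     \<le> (\<Prod>i\<in>UNIV. (\<Sum>x\<in>slab A (S - {i}) z. g i x) powr (1 / (real CARD('n) - 1)))"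
proof -
  define r where "r = 1 / (real CARD('n) - 1)"
  define I where "I S i z = (\<Sum>x\<in>slab A S z. g i x)" for S i z
  have card': "card (UNIV - {i}) = CARD('n) - 1" for i :: 'n
    by (simp add: card_Diff_singleton)
  have r: "r = 1 / real (card (UNIV - {i}))" for i :: 'n
    using n unfolding card' r_def by (simp add: of_nat_diff)
  have ne: "UNIV - {i} \<noteq> {}" for i :: 'n
  proof
    assume "UNIV - {i} = {}"
    then have "card (UNIV - {i}) = 0" by (simp only: card.empty)
    then show False using n card'[of i] by linarith
  qed
  have I_nonneg: "I S i z \<ge> 0" for S i z
    by (simp add: I_def sum_nonneg g)
  have "finite S" by simp
  then have "(\<Sum>x\<in>slab A S z. \<Prod>i\<in>UNIV. g i x powr r) \<le> (\<Prod>i\<in>UNIV. I (S - {i}) i z powr r)"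
  proof (induction S arbitrary: z)
    case empty
    show ?case by (simp add: I_def)
  next
    case (insert i S)
    have Si: "S - {i} = S" using insert.hyps by blast
    have indep: "I S i (upd z i t) = I S i z" for t
      unfolding I_def by (simp add: sum_slab_upd insert.hyps g)
    have I_insert: "(\<Sum>t\<in>A i. I (S - {j}) j (upd z i t)) = I (insert i S - {j}) j z" if "j \<noteq> i" for j
      using that insert.hyps unfolding I_def
      by (simp add: insert_Diff_if sum_slab_insert[OF A])
    have "(\<Sum>x\<in>slab A (insert i S) z. \<Prod>i\<in>UNIV. g i x powr r)
       = (\<Sum>t\<in>A i. \<Sum>x\<in>slab A S (upd z i t). \<Prod>i\<in>UNIV. g i x powr r)"
      by (rule sum_slab_insert[OF A insert.hyps(2)])
    also have "\<dots> \<le> (\<Sum>t\<in>A i. \<Prod>j\<in>UNIV. I (S - {j}) j (upd z i t) powr r)"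
      by (intro sum_mono insert.IH)
    also have "\<dots> = (\<Sum>t\<in>A i. I S i z powr r * (\<Prod>j\<in>UNIV-{i}. I (S - {j}) j (upd z i t) powr r))"
      by (intro sum.cong refl) (simp add: prod.remove[of UNIV i] Si indep)
    also have "\<dots> = I S i z powr r * (\<Sum>t\<in>A i. \<Prod>j\<in>UNIV-{i}. I (S - {j}) j (upd z i t) powr r)"
      by (simp add: sum_distrib_left)
    also have "\<dots> \<le> I S i z powr r * (\<Prod>j\<in>UNIV-{i}. (\<Sum>t\<in>A i. I (S - {j}) j (upd z i t)) powr r)"
      unfolding r[of i]
      by (intro mult_left_mono Hoelder_sum) (use ne A I_nonneg in auto)
    also have "\<dots> = I S i z powr r * (\<Prod>j\<in>UNIV-{i}. I (insert i S - {j}) j z powr r)"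
      by (simp add: I_insert)
    also have "\<dots> = (\<Prod>j\<in>UNIV. I (insert i S - {j}) j z powr r)"
      using insert.hyps by (simp add: prod.remove[of UNIV i])
    finally show ?case .
  qed
  then show ?thesis by (simp add: I_def r_def)
qed

section \<open>Inequalities in one variable\<close>

lemma summation_by_parts_1d:
  fixes v g :: "nat \<Rightarrow> real"
  assumes "m \<ge> 1" "v 0 = 0" "v m = 0"
  shows "(\<Sum>j\<in>{1..<m}. v j * (2 * g j - g (j+1) - g (j-1)))
       = (\<Sum>j<m. (v (j+1) - v j) * (g (j+1) - g j))"
proof -
  \<comment> \<open>The upper end is left free for the induction; the extra boundary term vanishes
    at \<open>k = m - 1\<close>, where \<open>v (Suc k) = v m = 0\<close>.\<close>
  have "(\<Sum>j\<in>{1..<Suc k}. v j * (2 * g j - g (j+1) - g (j-1)))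
      = (\<Sum>j<Suc k. (v (j+1) - v j) * (g (j+1) - g j)) - v (Suc k) * (g (Suc k) - g k)" for k
  proof (induction k)
    case 0
    then show ?case using assms(2) by (simp add: algebra_simps)
  next
    case (Suc k)
    have "{1..<Suc (Suc k)} = insert (Suc k) {1..<Suc k}" by auto
    then show ?case using Suc by (simp add: algebra_simps)
  qed
  from this[of "m - 1"] show ?thesis using assms by simp
qed

text \<open>The value \<open>v j\<close> telescopes from either end point, over \<open>j\<close> or
  \<open>m - j\<close> increments. Cauchy-Schwarz gives one bound for each end, and the smaller of
  the two degenerates at both ends.\<close>

lemma square_le_energy_1d:
  fixes v :: "nat \<Rightarrow> real"
  assumes "j \<le> m" "v 0 = 0" "v m = 0"
  shows "(v j)\<^sup>2 \<le> min (real j) (real (m - j)) * (\<Sum>k<m. (v (k+1) - v k)\<^sup>2)"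
proof -
  let ?d = "\<lambda>k. v (k+1) - v k"
  have CS: "(\<Sum>k\<in>I. ?d k)\<^sup>2 \<le> real (card I) * (\<Sum>k<m. (?d k)\<^sup>2)" if "I \<subseteq> {..<m}" for I
  proof -
    have fin: "finite I" using that by (simp add: finite_subset)
    have "(\<Sum>k\<in>I. 1 * ?d k)\<^sup>2 \<le> (\<Sum>k\<in>I. 1\<^sup>2) * (\<Sum>k\<in>I. (?d k)\<^sup>2)"
      by (rule Cauchy_Schwarz_ineq_sum)
    also have "\<dots> \<le> real (card I) * (\<Sum>k<m. (?d k)\<^sup>2)"
      using that by (simp, intro mult_left_mono sum_mono2) auto
    finally show ?thesis by simp
  qed
  have 1: "(\<Sum>k\<in>{..<j}. ?d k) = v j"
    using sum_lessThan_telescope[of v j] assms(2) by simp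
  have 2: "(\<Sum>k\<in>{j..<m}. ?d k) = - v j"
    using sum_Suc_diff'[of j m v] assms by simp
  have "(v j)\<^sup>2 \<le> real j * (\<Sum>k<m. (?d k)\<^sup>2)"
    using CS[of "{..<j}"] assms(1) unfolding 1 by (simp add: subset_eq)
  moreover have "(v j)\<^sup>2 \<le> real (m - j) * (\<Sum>k<m. (?d k)\<^sup>2)"
    using CS[of "{j..<m}"] unfolding 2 by (simp add: subset_eq)
  ultimately show ?thesis by (simp add: min_def)
qed

text \<open>Jordan's inequality: sine is concave on \<open>{0..pi/2}\<close>, hence lies above its
  chord.\<close>

lemma sin_ge_chord:
  assumes "0 \<le> x" "x \<le> pi / 2"
  shows "2 * x / pi \<le> sin x"
proof -
  have "convex_on {0..pi/2} (\<lambda>x. - sin x)"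
  proof (rule f''_ge0_imp_convex[where f' = "\<lambda>x. - cos x" and f'' = sin])
    show "0 \<le> sin x" if "x \<in> {0..pi/2}" for x using that by (intro sin_ge_zero) auto
  qed (auto intro!: derivative_eq_intros)
  from convex_onD[OF this, of "2 * x / pi" 0 "pi/2"] show ?thesis
    using assms by (simp add: field_simps)
qed

text \<open>Turns the factor \<open>min j (m - j)\<close> of the one-dimensional estimate into a
  sine factor of the eigenfunction. The right half follows from the left one by reflection.\<close>

lemma sin_pi_ge_min:
  assumes "0 \<le> t" "t \<le> 1"
  shows "2 * min t (1 - t) \<le> sin (pi * t)"
proof (cases "t \<le> 1/2")
  case True
  have "2 * (pi * t) / pi \<le> sin (pi * t)"
    by (rule sin_ge_chord) (use assms True in \<open>auto simp: field_simps\<close>)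
  then show ?thesis using True by simp
next
  case False
  have "2 * (pi * (1 - t)) / pi \<le> sin (pi * (1 - t))"
    by (rule sin_ge_chord) (use assms False in \<open>auto simp: field_simps\<close>)
  also have "sin (pi * (1 - t)) = sin (pi * t)"
    by (simp add: right_diff_distrib)
  finally show ?thesis using False by simp
qed

text \<open>For \<open>d = (\<Psi> b - \<Psi> a) / (b - a)\<close>, the function \<open>\<psi> - 2 d \<Psi> + d\<^sup>2 t\<close> has the derivative
  \<open>\<psi>' - 2 d \<Psi>' + d\<^sup>2 \<ge> (\<Psi>' - d)\<^sup>2 \<ge> 0\<close>.\<close>

lemma increment_square_le:
  fixes \<psi> \<Psi> :: "real \<Rightarrow> real"
  assumes "a \<le> b"
    and \<psi>: "\<And>t. a \<le> t \<Longrightarrow> t \<le> b \<Longrightarrow> (\<psi> has_real_derivative \<psi>' t) (at t)"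
    and \<Psi>: "\<And>t. a \<le> t \<Longrightarrow> t \<le> b \<Longrightarrow> (\<Psi> has_real_derivative \<Psi>' t) (at t)"
    and le: "\<And>t. a \<le> t \<Longrightarrow> t \<le> b \<Longrightarrow> (\<Psi>' t)\<^sup>2 \<le> \<psi>' t"
  shows "(\<Psi> b - \<Psi> a)\<^sup>2 \<le> (b - a) * (\<psi> b - \<psi> a)"
proof (cases "a = b")
  case False
  with assms(1) have ab: "b - a > 0" by simp
  define d where "d = (\<Psi> b - \<Psi> a) / (b - a)"
  have "\<psi> a - 2 * d * \<Psi> a + d\<^sup>2 * a \<le> \<psi> b - 2 * d * \<Psi> b + d\<^sup>2 * b"
  proof (rule DERIV_nonneg_imp_nondecreasing[OF assms(1)])
    fix t assume t: "a \<le> t" "t \<le> b"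
    have "((\<lambda>t. \<psi> t - 2 * d * \<Psi> t + d\<^sup>2 * t) has_real_derivative \<psi>' t - 2 * d * \<Psi>' t + d\<^sup>2) (at t)"
      by (auto intro!: derivative_eq_intros \<psi> \<Psi> t)
    moreover have "\<psi>' t - 2 * d * \<Psi>' t + d\<^sup>2 \<ge> (\<Psi>' t - d)\<^sup>2"
      using le[OF t] by (simp add: power2_diff algebra_simps)
    ultimately show "\<exists>y. ((\<lambda>t. \<psi> t - 2 * d * \<Psi> t + d\<^sup>2 * t) has_real_derivative y) (at t) \<and> 0 \<le> y"
      by (meson order_trans zero_le_power2)
  qed
  then have "2 * d * (\<Psi> b - \<Psi> a) - d\<^sup>2 * (b - a) \<le> \<psi> b - \<psi> a"
    by (simp add: algebra_simps)
  moreover have "2 * d * (\<Psi> b - \<Psi> a) - d\<^sup>2 * (b - a) = (\<Psi> b - \<Psi> a)\<^sup>2 / (b - a)"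
  proof -
    have "\<Psi> b - \<Psi> a = d * (b - a)" using ab by (simp add: d_def)
    then show ?thesis using ab by (simp add: power2_eq_square)
  qed
  ultimately have "(\<Psi> b - \<Psi> a)\<^sup>2 / (b - a) \<le> \<psi> b - \<psi> a" by simp
  then show ?thesis using ab by (simp add: pos_divide_le_eq mult.commute)
qed simp

text \<open>A discrete chain rule: the squared derivative of
  \<open>(t + \<kappa>) powr ((1 - e) / 2)\<close> is at most the derivative of
  \<open>- ((t + \<kappa>) powr (- e)) / e\<close>, and \<open>increment_square_le\<close> passes to
  increments. It bounds the energy of a truncated power of \<open>G\<close> by testing the equation
  of \<open>G\<close> with a bounded function.\<close>

lemma truncation_increment_le:
  fixes e \<kappa> s t :: real
  assumes e: "0 < e" "e < 1" and \<kappa>: "0 < \<kappa>" and st: "0 \<le> s" "0 \<le> t"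
  shows "((t + \<kappa>) powr ((1 - e) / 2) - (s + \<kappa>) powr ((1 - e) / 2))\<^sup>2
     \<le> (t - s) * (((s + \<kappa>) powr (- e) - (t + \<kappa>) powr (- e)) / e)"
proof -
  have *: "((t + \<kappa>) powr ((1 - e) / 2) - (s + \<kappa>) powr ((1 - e) / 2))\<^sup>2
     \<le> (t - s) * (- ((t + \<kappa>) powr (- e)) / e - (- ((s + \<kappa>) powr (- e)) / e))"
    if "0 \<le> s" "s \<le> t" for s t
  proof (rule increment_square_le[where \<psi>' = "\<lambda>t. (t + \<kappa>) powr (- e - 1)" and
        \<Psi>' = "\<lambda>t. (1 - e) / 2 * (t + \<kappa>) powr ((1 - e) / 2 - 1)"])
    fix x assume x: "s \<le> x" "x \<le> t"
    show "((\<lambda>t. - ((t + \<kappa>) powr - e) / e) has_real_derivative (x + \<kappa>) powr (- e - 1)) (at x)"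
      using e \<kappa> that x by (auto intro!: derivative_eq_intros)
    show "((\<lambda>t. (t + \<kappa>) powr ((1 - e) / 2)) has_real_derivative
            (1 - e) / 2 * (x + \<kappa>) powr ((1 - e) / 2 - 1)) (at x)"
      using e \<kappa> that x by (auto intro!: derivative_eq_intros)
    have "((x + \<kappa>) powr ((1 - e) / 2 - 1))\<^sup>2 = (x + \<kappa>) powr (- e - 1)"
    proof -
      have "(1 - e) / 2 - 1 + ((1 - e) / 2 - 1) = - e - 1" by (simp add: field_simps)
      then show ?thesis unfolding power2_eq_square powr_add[symmetric] by (simp only:)
    qed
    moreover have "((1 - e) / 2)\<^sup>2 \<le> 1"
      using e by (simp add: power_le_one)
    ultimately show "((1 - e) / 2 * (x + \<kappa>) powr ((1 - e) / 2 - 1))\<^sup>2 \<le> (x + \<kappa>) powr (- e - 1)"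
      unfolding power_mult_distrib by (simp add: mult_left_le_one_le)
  qed (use that in auto)
  show ?thesis
  proof (cases "s \<le> t")
    case True
    then show ?thesis using *[of s t] st by (simp add: diff_divide_distrib)
  next
    case False
    \<comment> \<open>Both sides are symmetric in \<open>s\<close> and \<open>t\<close>, so the
      ordered case suffices.\<close>
    have "(s - t) * (- ((s + \<kappa>) powr - e) / e - - ((t + \<kappa>) powr - e) / e)
        = (t - s) * (((s + \<kappa>) powr (- e) - (t + \<kappa>) powr (- e)) / e)"
      by (simp add: diff_divide_distrib algebra_simps)
    then show ?thesis using *[of t s] st False by (simp add: power2_commute)
  qed
qed

text \<open>Here \<open>2 * \<kappa> \<le> t + \<kappa>\<close>, so the subtracted power is at most
  the fraction \<open>2 powr (- s)\<close> of the first. Above the level \<open>\<kappa>\<close> the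
  truncated power is thus comparable to the power itself, with a constant independent of
  \<open>\<kappa>\<close>.\<close>

lemma powr_increment_ge:
  fixes s \<kappa> t :: real
  assumes "0 < s" "0 < \<kappa>" "\<kappa> \<le> t"
  shows "(1 - 2 powr (- s)) * t powr s \<le> (t + \<kappa>) powr s - \<kappa> powr s"
proof -
  have "2 powr (- s) * (2 * \<kappa>) powr s \<le> 2 powr (- s) * (t + \<kappa>) powr s"
    using assms by (intro mult_left_mono powr_mono2) auto
  then have "\<kappa> powr s \<le> 2 powr (- s) * (t + \<kappa>) powr s"
    using assms by (simp add: powr_mult powr_minus field_simps)
  then have "(1 - 2 powr (- s)) * (t + \<kappa>) powr s \<le> (t + \<kappa>) powr s - \<kappa> powr s"
    by (simp add: algebra_simps)
  moreover have "(1 - 2 powr (- s)) * t powr s \<le> (1 - 2 powr (- s)) * (t + \<kappa>) powr s"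
    using assms by (intro mult_left_mono powr_mono2) (auto simp: powr_minus field_simps ge_one_powr_ge_zero)
  ultimately show ?thesis by linarith
qed

text \<open>For \<open>M > 1\<close> every term on the right is at most a constant times
  \<open>M powr (p * \<alpha>)\<close>, and this power can be divided out because
  \<open>p * \<alpha> < 1\<close>.\<close>

lemma sublinear_bound:
  fixes A B C D p \<alpha> M :: real
  assumes "A \<ge> 0" "B \<ge> 0" "C \<ge> 0" "D \<ge> 0" "0 < p" "0 < \<alpha>" "p * \<alpha> < 1"
    and M: "M \<ge> 0" "M \<le> A + B * (C * M powr p + D) powr \<alpha>"
  shows "M \<le> max 1 ((A + B * (C + D) powr \<alpha>) powr (1 / (1 - p * \<alpha>)))"
proof (cases "M \<le> 1")
  case False
  then have M1: "M > 1" by simp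
  have "C * M powr p + D \<le> (C + D) * M powr p"
    using M1 assms by (simp add: distrib_right ge_one_powr_ge_zero mult_left_le_one_le mult_le_cancel_left1)
  then have "(C * M powr p + D) powr \<alpha> \<le> ((C + D) * M powr p) powr \<alpha>"
    using assms by (intro powr_mono2) auto
  also have "\<dots> = (C + D) powr \<alpha> * M powr (p * \<alpha>)"
    using assms by (simp add: powr_mult powr_powr)
  finally have "B * (C * M powr p + D) powr \<alpha> \<le> B * ((C + D) powr \<alpha> * M powr (p * \<alpha>))"
    using assms by (intro mult_left_mono)
  moreover have "A \<le> A * M powr (p * \<alpha>)"
    using assms M1 by (simp add: ge_one_powr_ge_zero mult_le_cancel_left1)
  ultimately have "M \<le> (A + B * (C + D) powr \<alpha>) * M powr (p * \<alpha>)"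
    using M(2) by (simp add: algebra_simps)
  then have "M powr (1 - p * \<alpha>) \<le> A + B * (C + D) powr \<alpha>"
    using M1 by (simp add: powr_diff field_simps)
  then have "(M powr (1 - p * \<alpha>)) powr (1 / (1 - p * \<alpha>)) \<le> (A + B * (C + D) powr \<alpha>) powr (1 / (1 - p * \<alpha>))"
    using assms by (intro powr_mono2) auto
  then show ?thesis using M1 assms by (simp add: powr_powr)
qed simp

section \<open>Summation by parts on the grid\<close>

text \<open>Admissibility with its integers chosen as functions of the direction: \<open>m i\<close>
  counts the mesh intervals along direction \<open>i\<close>, so the interior nodes are those
  numbered 1 to \<open>m i - 1\<close>.\<close>

locale mesh =
  fixes a b h :: "real^'n" and k :: "'n \<Rightarrow> int" and m :: "'n \<Rightarrow> nat"
  assumes h_pos: "h$i > 0"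
    and a_eq: "a$i = of_int (k i) * h$i"
    and b_eq: "b$i = a$i + real (m i) * h$i"
    and m_ge_2: "m i \<ge> 2"
begin

definition node :: "'n \<Rightarrow> nat \<Rightarrow> real" where
  "node i j = a$i + real j * h$i"

definition A :: "'n \<Rightarrow> real set" where
  "A i = node i ` {1..<m i}"

definition pt :: "real^'n \<Rightarrow> 'n \<Rightarrow> nat \<Rightarrow> real^'n" where
  "pt y i j = upd y i (node i j)"

text \<open>A line is labelled by its point on the face with \<open>i\<close>-th coordinate
  \<open>a$i\<close>; its other coordinates are interior nodes.\<close>

abbreviation lines :: "'n \<Rightarrow> (real^'n) set" where
  "lines i \<equiv> slab A (UNIV - {i}) a"

abbreviation X :: "(real^'n) set" where
  "X \<equiv> grid_interior a b h"

text \<open>The volume of a mesh cell: \<open>w\<close> times a sum over \<open>X\<close> is a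
  discrete integral.\<close>

definition w :: real where
  "w = (\<Prod>i\<in>UNIV. h$i)"

text \<open>The discrete Dirichlet form without the cell volume. Every edge of a line counts,
  including the two that touch the boundary.\<close>

definition dform :: "(real^'n \<Rightarrow> real) \<Rightarrow> (real^'n \<Rightarrow> real) \<Rightarrow> real" where
  "dform u v = (\<Sum>i\<in>UNIV. \<Sum>y\<in>lines i. \<Sum>j<m i.
     (v (pt y i (j+1)) - v (pt y i j)) * (u (pt y i (j+1)) - u (pt y i j)) / (h$i)\<^sup>2)"

lemma h_nonneg [simp]: "h$i \<ge> 0" and h_neq_0 [simp]: "h$i \<noteq> 0"
  using h_pos[of i] by auto

lemma w_pos: "w > 0"
  unfolding w_def by (intro prod_pos) (simp add: h_pos)

lemma a_less_b: "a$i < b$i"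
  using b_eq[of i] h_pos[of i] m_ge_2[of i] by simp

lemma length_eq: "b$i - a$i = real (m i) * h$i"
  using b_eq[of i] by simp

lemma node_lattice: "\<exists>z::int. node i j = h$i * of_int z"
  by (rule exI[of _ "k i + int j"]) (simp add: node_def a_eq algebra_simps)

lemma lattice_node:
  fixes z :: int
  assumes "a$i \<le> h$i * of_int z"
  shows "h$i * of_int z = node i (nat (z - k i))"
proof -
  have "h$i * of_int (k i) \<le> h$i * of_int z" using assms by (simp add: a_eq mult.commute)
  then have "k i \<le> z" using h_pos[of i] by (simp add: mult_le_cancel_left)
  then show ?thesis by (simp add: node_def a_eq algebra_simps)
qed

lemma node_bounds [simp]:
  "a$i \<le> node i j" "a$i < node i j \<longleftrightarrow> 0 < j"
  "node i j \<le> b$i \<longleftrightarrow> j \<le> m i" "node i j < b$i \<longleftrightarrow> j < m i"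
  using h_pos[of i] by (simp_all add: node_def b_eq zero_less_mult_iff mult_le_cancel_right mult_less_cancel_right)

lemma grid_closed_iff: "x \<in> grid_closed a b h \<longleftrightarrow> (\<forall>i. \<exists>j\<le>m i. x$i = node i j)"
proof
  assume x: "x \<in> grid_closed a b h"
  show "\<forall>i. \<exists>j\<le>m i. x$i = node i j"
  proof
    fix i
    obtain z :: int where z: "x$i = h$i * of_int z" and ab: "a$i \<le> x$i" "x$i \<le> b$i"
      using x unfolding grid_closed_def lattice_def Int_iff mem_Collect_eq mem_box_cart by metis
    have "x$i = node i (nat (z - k i))" using lattice_node[of i z] z ab by simp
    then show "\<exists>j\<le>m i. x$i = node i j" using ab by (metis node_bounds(3))
  qed
next
  assume "\<forall>i. \<exists>j\<le>m i. x$i = node i j"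
  then show "x \<in> grid_closed a b h"
    unfolding grid_closed_def lattice_def Int_iff mem_Collect_eq
    by (metis node_lattice node_bounds(1,3) mem_box_cart(2))
qed

lemma grid_interior_iff: "x \<in> X \<longleftrightarrow> (\<forall>i. x$i \<in> A i)"
proof
  assume x: "x \<in> X"
  show "\<forall>i. x$i \<in> A i"
  proof
    fix i
    obtain z :: int where z: "x$i = h$i * of_int z" and ab: "a$i < x$i" "x$i < b$i"
      using x unfolding grid_interior_def lattice_def Int_iff mem_Collect_eq mem_box_cart by metis
    have eq: "x$i = node i (nat (z - k i))" using lattice_node[of i z] z ab by simp
    show "x$i \<in> A i" unfolding A_def
      using ab unfolding eq by (intro imageI) simp
  qed
next
  assume *: "\<forall>i. x$i \<in> A i"
  have "\<exists>j\<in>{1..<m i}. x$i = node i j" for i using * by (auto simp: A_def)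
  then show "x \<in> X"
    unfolding grid_interior_def lattice_def Int_iff mem_Collect_eq mem_box_cart
    by (metis node_lattice node_bounds(2,4) atLeastLessThan_iff less_le_trans zero_less_one)
qed

lemma grid_interior_slab: "X = slab A UNIV z"
  by (auto simp: grid_interior_iff slab_def)

lemma interior_closed: "X \<subseteq> grid_closed a b h"
  by (auto simp: grid_interior_def grid_closed_def dest: box_subset_cbox[THEN subsetD])

lemma boundary_iff: "x \<in> grid_boundary a b h \<longleftrightarrow> x \<in> grid_closed a b h \<and> x \<notin> X"
  by (auto simp: grid_boundary_def grid_interior_def grid_closed_def)

lemma finite_A [simp]: "finite (A i)"
  by (simp add: A_def)

lemma finite_X [simp]: "finite X"
  by (simp add: grid_interior_slab[of 0])

lemma sum_A: "sum F (A i) = (\<Sum>j\<in>{1..<m i}. F (node i j))"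
  unfolding A_def by (subst sum.reindex) (auto simp: inj_on_def node_def)

lemma pt_nth: "pt y i j $ l = (if l = i then node i j else y $ l)"
  by (simp add: pt_def)

lemma sum_X: "sum F X = (\<Sum>y\<in>lines i. \<Sum>j\<in>{1..<m i}. F (pt y i j))"
  by (simp add: grid_interior_slab[of a] sum_slab_lines[of A F a i] sum_A pt_def)

lemma lines_iff: "y \<in> lines i \<longleftrightarrow> y$i = a$i \<and> (\<forall>l. l \<noteq> i \<longrightarrow> y$l \<in> A l)"
  by (auto simp: slab_def)

lemma pt_add: "pt y i j + h$i *\<^sub>R axis i 1 = pt y i (j+1)"
  by (simp add: vec_eq_iff pt_nth axis_def node_def algebra_simps)

lemma pt_diff: "j \<ge> 1 \<Longrightarrow> pt y i j - h$i *\<^sub>R axis i 1 = pt y i (j-1)"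
  by (simp add: vec_eq_iff pt_nth axis_def node_def of_nat_diff algebra_simps)

lemma interior_pt:
  assumes "x \<in> X"
  obtains j where "j \<in> {1..<m i}" "x = pt x i j"
proof -
  have "x$i \<in> A i" using assms grid_interior_iff by blast
  then obtain j where "j \<in> {1..<m i}" "x$i = node i j" by (auto simp: A_def)
  moreover from this have "x = pt x i j" by (simp add: vec_eq_iff pt_nth)
  ultimately show ?thesis using that by blast
qed

lemma pt_closed: "(\<And>l. l \<noteq> i \<Longrightarrow> y$l \<in> A l) \<Longrightarrow> j \<le> m i \<Longrightarrow> pt y i j \<in> grid_closed a b h"
  unfolding grid_closed_iff pt_nth by (auto simp: A_def) (metis imageE atLeastLessThan_iff less_imp_le)

lemma neighbour_closed:
  assumes "x \<in> X"
  shows "x + h$i *\<^sub>R axis i 1 \<in> grid_closed a b h" "x - h$i *\<^sub>R axis i 1 \<in> grid_closed a b h"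
proof -
  obtain j where j: "j \<in> {1..<m i}" "x = pt x i j" by (rule interior_pt[OF assms])
  have c: "pt x i l \<in> grid_closed a b h" if "l \<le> m i" for l
    using assms that by (intro pt_closed) (auto simp: grid_interior_iff)
  have "pt x i j + h$i *\<^sub>R axis i 1 \<in> grid_closed a b h"
    unfolding pt_add using j(1) by (intro c) auto
  then show "x + h$i *\<^sub>R axis i 1 \<in> grid_closed a b h" using j(2) by simp
  have "pt x i j - h$i *\<^sub>R axis i 1 \<in> grid_closed a b h"
    using j(1) by (subst pt_diff) (auto intro!: c)
  then show "x - h$i *\<^sub>R axis i 1 \<in> grid_closed a b h" using j(2) by simp
qed

lemma pt_boundary:
  assumes "y \<in> lines i"
  shows "pt y i 0 \<in> grid_boundary a b h" "pt y i (m i) \<in> grid_boundary a b h"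
proof -
  have "pt y i j \<in> grid_closed a b h" if "j \<le> m i" for j
    using that assms by (intro pt_closed) (auto simp: lines_iff)
  moreover have "pt y i j \<notin> X" if "j = 0 \<or> j = m i" for j
    using that unfolding grid_interior_def mem_box_cart Int_iff by (metis pt_nth node_bounds(2,4) less_irrefl)
  ultimately show "pt y i 0 \<in> grid_boundary a b h" "pt y i (m i) \<in> grid_boundary a b h"
    by (auto simp: boundary_iff)
qed

text \<open>The Laplacian is a sum of second differences in single directions, so the claim splits
  into lines. There it is \<open>summation_by_parts_1d\<close>, since both ends of a line are
  boundary points.\<close>

lemma summation_by_parts:
  assumes v: "\<And>x. x \<in> grid_boundary a b h \<Longrightarrow> v x = 0"
  shows "(\<Sum>x\<in>X. v x * (- discrete_laplacian h u x)) = dform u v"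
proof -
  define L where "L i x = (2 * u x - u (x + h$i *\<^sub>R axis i 1) - u (x - h$i *\<^sub>R axis i 1))" for i x
  have "(\<Sum>x\<in>X. v x * (- discrete_laplacian h u x)) = (\<Sum>x\<in>X. \<Sum>i\<in>UNIV. v x * L i x / (h$i)\<^sup>2)"
  proof (rule sum.cong[OF refl])
    fix x
    have "- discrete_laplacian h u x = (\<Sum>i\<in>UNIV. L i x / (h$i)\<^sup>2)"
      unfolding discrete_laplacian_def sum_negf[symmetric]
      by (intro sum.cong refl) (simp add: L_def minus_divide_left del: divide_minus_left)
    then show "v x * (- discrete_laplacian h u x) = (\<Sum>i\<in>UNIV. v x * L i x / (h$i)\<^sup>2)"
      by (simp only: sum_distrib_left times_divide_eq_right)
  qed
  also have "\<dots> = (\<Sum>i\<in>UNIV. \<Sum>x\<in>X. v x * L i x / (h$i)\<^sup>2)"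
    by (rule sum.swap)
  also have "\<dots> = dform u v"
    unfolding dform_def
  proof (rule sum.cong[OF refl])
    fix i
    show "(\<Sum>x\<in>X. v x * L i x / (h$i)\<^sup>2) = (\<Sum>y\<in>lines i. \<Sum>j<m i.
     (v (pt y i (j+1)) - v (pt y i j)) * (u (pt y i (j+1)) - u (pt y i j)) / (h$i)\<^sup>2)"
      unfolding sum_X[of _ i]
    proof (rule sum.cong[OF refl])
      fix y assume y: "y \<in> lines i"
      have "(\<Sum>j\<in>{1..<m i}. v (pt y i j) * L i (pt y i j))
          = (\<Sum>j\<in>{1..<m i}. v (pt y i j) * (2 * u (pt y i j) - u (pt y i (j+1)) - u (pt y i (j-1))))"
        by (intro sum.cong refl) (simp add: L_def pt_add[unfolded Suc_eq_plus1[symmetric]] pt_diff)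
      also have "\<dots> = (\<Sum>j<m i. (v (pt y i (j+1)) - v (pt y i j)) * (u (pt y i (j+1)) - u (pt y i j)))"
        using m_ge_2[of i] pt_boundary[OF y] v by (intro summation_by_parts_1d) auto
      finally show "(\<Sum>j\<in>{1..<m i}. v (pt y i j) * L i (pt y i j) / (h$i)\<^sup>2)
          = (\<Sum>j<m i. (v (pt y i (j+1)) - v (pt y i j)) * (u (pt y i (j+1)) - u (pt y i j)) / (h$i)\<^sup>2)"
        by (simp only: sum_divide_distrib[symmetric])
    qed
  qed
  finally show ?thesis .
qed

lemma dform_commute: "dform u v = dform v u"
  by (simp add: dform_def mult.commute)

lemma Green_identity:
  assumes "\<And>x. x \<in> grid_boundary a b h \<Longrightarrow> u x = 0" "\<And>x. x \<in> grid_boundary a b h \<Longrightarrow> v x = 0"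
  shows "(\<Sum>x\<in>X. v x * (- discrete_laplacian h u x)) = (\<Sum>x\<in>X. u x * (- discrete_laplacian h v x))"
  using summation_by_parts[of v u] summation_by_parts[of u v] assms by (simp add: dform_commute)

end

section \<open>The weighted Sobolev inequality and the Green function\<close>

context mesh
begin

section \<open>The product of sines as a discrete eigenfunction\<close>

definition s :: "'n \<Rightarrow> real^'n \<Rightarrow> real" where
  "s i x = sin (pi * ((x$i - a$i) / (b$i - a$i)))"

definition phi :: "real^'n \<Rightarrow> real" where
  "phi x = (\<Prod>i\<in>UNIV. s i x)"

lemma s_pt: "s i (pt y i j) = sin (pi * (real j / real (m i)))"
  by (simp add: s_def pt_nth length_eq) (simp add: node_def)

lemma s_pos:
  assumes "x \<in> X"
  shows "s i x > 0"
proof -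
  have "a$i < x$i" "x$i < b$i"
    using assms by (auto simp: grid_interior_def mem_box_cart)
  then show ?thesis unfolding s_def
    by (intro sin_gt_zero) (auto simp: field_simps)
qed

lemma s_le_1: "s i x \<le> 1"
  by (simp add: s_def)

lemma phi_pos: "x \<in> X \<Longrightarrow> phi x > 0"
  unfolding phi_def by (intro prod_pos) (simp add: s_pos)

lemma phi_le_1: "x \<in> X \<Longrightarrow> phi x \<le> 1"
  unfolding phi_def by (intro prod_le_1) (simp add: s_le_1 s_pos less_imp_le)

lemma phi_boundary:
  assumes "x \<in> grid_boundary a b h"
  shows "phi x = 0"
proof -
  obtain i where i: "x$i \<notin> A i" using assms boundary_iff grid_interior_iff by blast
  obtain j where j: "j \<le> m i" "x$i = node i j" using assms boundary_iff grid_closed_iff by blast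
  have "j = 0 \<or> j = m i" using i j by (force simp: A_def)
  moreover have "x = pt x i j" using j by (simp add: vec_eq_iff pt_nth)
  then have "s i x = sin (pi * (real j / real (m i)))" by (metis s_pt)
  ultimately have "s i x = 0" using m_ge_2[of i] by auto
  then show ?thesis by (auto simp: phi_def)
qed

definition eig :: real where
  "eig = (\<Sum>i\<in>UNIV. 2 * (1 - cos (pi * h$i / (b$i - a$i))) / (h$i)\<^sup>2)"

text \<open>In each direction only one sine factor changes, and
  \<open>sin (t + d) + sin (t - d) = 2 * sin t * cos d\<close>. The identity therefore holds at
  every real point \<open>x\<close>.\<close>

lemma phi_eigenfunction: "- discrete_laplacian h phi x = eig * phi x"
proof -
  have "(phi (x + h$i *\<^sub>R axis i 1) - 2 * phi x + phi (x - h$i *\<^sub>R axis i 1)) / (h$i)\<^sup>2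
      = - (2 * (1 - cos (pi * h$i / (b$i - a$i))) / (h$i)\<^sup>2 * phi x)" for i
  proof -
    let ?t = "pi * ((x$i - a$i) / (b$i - a$i))" and ?d = "pi * h$i / (b$i - a$i)"
    define R where "R = (\<Prod>l\<in>UNIV-{i}. s l x)"
    have split: "phi y = s i y * R" if "\<And>l. l \<noteq> i \<Longrightarrow> y$l = x$l" for y
      unfolding phi_def R_def by (subst prod.remove[of UNIV i]) (auto simp: s_def that intro!: prod.cong)
    have "phi (x + h$i *\<^sub>R axis i 1) = sin (?t + ?d) * R"
      by (subst split) (auto simp: axis_def s_def add_divide_distrib diff_divide_distrib algebra_simps)
    moreover have "phi (x - h$i *\<^sub>R axis i 1) = sin (?t - ?d) * R"
      by (subst split) (auto simp: axis_def s_def add_divide_distrib diff_divide_distrib algebra_simps)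
    moreover have "phi x = sin ?t * R" by (subst split) (auto simp: s_def)
    ultimately have "phi (x + h$i *\<^sub>R axis i 1) - 2 * phi x + phi (x - h$i *\<^sub>R axis i 1)
        = - (2 * (1 - cos ?d) * phi x)"
      by (simp add: sin_add sin_diff algebra_simps)
    then show ?thesis by simp
  qed
  then show ?thesis
    by (simp add: discrete_laplacian_def eig_def sum_negf sum_distrib_right)
qed

text \<open>By the half-angle formula \<open>1 - cos d\<close> is at most \<open>d^2 / 2\<close>.
  Hence the spectral gap assumed for the continuous eigenvalue serves every mesh at once.\<close>

lemma eig_le: "eig \<le> lambda1 a b"
  unfolding eig_def lambda1_def
proof (rule sum_mono)
  fix i
  define d where "d = pi * h$i / (b$i - a$i)"
  have "1 - cos d = 2 * (sin (d/2))\<^sup>2" using cos_double_sin[of "d/2"] by simp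
  also have "\<dots> \<le> 2 * (d/2)\<^sup>2"
    using abs_sin_x_le_abs_x[of "d/2"] unfolding abs_le_square_iff by (intro mult_left_mono) auto
  finally have "2 * (1 - cos d) / (h$i)\<^sup>2 \<le> d\<^sup>2 / (h$i)\<^sup>2"
    by (intro divide_right_mono) (auto simp: power2_eq_square)
  also have "d\<^sup>2 / (h$i)\<^sup>2 = pi\<^sup>2 / (b$i - a$i)\<^sup>2"
    by (simp add: d_def power_divide power_mult_distrib)
  finally show "2 * (1 - cos (pi * h$i / (b$i - a$i))) / (h$i)\<^sup>2 \<le> pi\<^sup>2 / (b$i - a$i)\<^sup>2"
    by (simp add: d_def)
qed

lemma volume_le: "w * real (card X) \<le> (\<Prod>i\<in>UNIV. b$i - a$i)"
proof -
  have "card (A i) \<le> m i" for i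
    unfolding A_def using card_image_le[of "{1..<m i}" "node i"] by simp
  then have "w * real (card X) \<le> w * (\<Prod>i\<in>UNIV. real (m i))"
    unfolding grid_interior_slab[of 0] card_slab[of A, OF finite_A] of_nat_prod
    using w_pos by (intro mult_left_mono prod_mono) auto
  also have "\<dots> = (\<Prod>i\<in>UNIV. b$i - a$i)"
    by (simp add: w_def length_eq prod.distrib mult.commute)
  finally show ?thesis .
qed

section \<open>Line energies and the weighted Sobolev inequality\<close>

definition line_energy :: "(real^'n \<Rightarrow> real) \<Rightarrow> 'n \<Rightarrow> real^'n \<Rightarrow> real" where
  "line_energy v i y = (\<Sum>j<m i. (v (pt y i (j+1)) - v (pt y i j))\<^sup>2 / (h$i)\<^sup>2)"

lemma line_energy_nonneg: "line_energy v i y \<ge> 0"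
  by (simp add: line_energy_def sum_nonneg)

text \<open>This is the independence of the \<open>i\<close>-th coordinate that
  \<open>Loomis_Whitney\<close> requires.\<close>

lemma line_energy_upd: "line_energy v i (upd y i t) = line_energy v i y"
  by (simp add: line_energy_def pt_def)

lemma dform_line_energy: "dform v v = (\<Sum>i\<in>UNIV. \<Sum>y\<in>lines i. line_energy v i y)"
  by (simp add: dform_def line_energy_def power2_eq_square)

lemma dform_nonneg: "dform v v \<ge> 0"
  by (simp add: dform_line_energy sum_nonneg line_energy_nonneg)

text \<open>The factor \<open>min j (m i - j)\<close> of the one-dimensional estimate is at most
  \<open>m i / 2 * s i x\<close>. As \<open>m i * h$i\<close> is the side length, a single power of
  \<open>h$i\<close> remains.\<close>

lemma square_div_s_le:
  assumes v: "\<And>x. x \<in> grid_boundary a b h \<Longrightarrow> v x = 0" and x: "x \<in> X"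
  shows "(v x)\<^sup>2 / s i x \<le> (b$i - a$i) / 2 * h$i * line_energy v i x"
proof -
  obtain j where j: "j \<in> {1..<m i}" "x = pt x i j" by (rule interior_pt[OF x])
  define y where "y = upd x i (a$i)"
  have y: "y \<in> lines i" using x by (auto simp: lines_iff y_def grid_interior_iff)
  have pt: "pt x i l = pt y i l" for l by (simp add: pt_def y_def)
  have m: "real (m i) > 0" using m_ge_2[of i] by simp
  have "(v x)\<^sup>2 = (v (pt y i j))\<^sup>2" using j(2) pt by metis
  also have "\<dots> \<le> min (real j) (real (m i - j)) * (\<Sum>l<m i. (v (pt y i (l+1)) - v (pt y i l))\<^sup>2)"
    using pt_boundary[OF y] v j(1) by (intro square_le_energy_1d) auto
  also have "(\<Sum>l<m i. (v (pt y i (l+1)) - v (pt y i l))\<^sup>2) = (h$i)\<^sup>2 * line_energy v i x"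
    by (simp add: line_energy_def pt sum_distrib_left)
  also have "min (real j) (real (m i - j)) = real (m i) / 2 * (2 * min (real j / real (m i)) (1 - real j / real (m i)))"
    using m j(1) by (simp add: min_def of_nat_diff field_simps)
  also have "\<dots> * ((h$i)\<^sup>2 * line_energy v i x)
      \<le> real (m i) / 2 * s i x * ((h$i)\<^sup>2 * line_energy v i x)"
  proof (intro mult_right_mono mult_left_mono)
    have "s i x = sin (pi * (real j / real (m i)))" using s_pt j(2) by metis
    then show "2 * min (real j / real (m i)) (1 - real j / real (m i)) \<le> s i x"
      using sin_pi_ge_min[of "real j / real (m i)"] j(1) by simp
  qed (simp_all add: line_energy_nonneg)
  also have "\<dots> = (b$i - a$i) / 2 * h$i * line_energy v i x * s i x"
    by (simp add: length_eq power2_eq_square)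
  finally show ?thesis using s_pos[OF x, of i] by (simp add: pos_divide_le_eq)
qed

text \<open>The one-dimensional estimate \<open>v\<^sup>2 \<le> C s\<^sub>i \<integral> \<bar>\<partial>\<^sub>i v\<bar>\<^sup>2\<close>
  makes \<open>v\<^sup>2 / s\<^sub>i\<close> bounded by a function that does not depend on the \<open>i\<close>-th coordinate, which is
  what the Loomis-Whitney inequality asks for.\<close>

lemma weighted_Sobolev:
  fixes v :: "real^'n \<Rightarrow> real"
  defines "n \<equiv> real CARD('n)" and "r \<equiv> 1 / (real CARD('n) - 1)"
  assumes n2: "CARD('n) \<ge> 2" and v: "\<And>x. x \<in> grid_boundary a b h \<Longrightarrow> v x = 0"
  shows "w * (\<Sum>x\<in>X. \<Prod>i\<in>UNIV. ((v x)\<^sup>2 / s i x) powr r)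
     \<le> (\<Prod>i\<in>UNIV. (b$i - a$i) / 2) powr r * (w * dform v v) powr (n * r)"
proof -
  define c where "c i = (b$i - a$i) / 2" for i
  define E where "E = dform v v"
  have r: "r > 0" "1 + r = n * r" using n2 by (auto simp: r_def n_def field_simps)
  have c: "c i > 0" for i using a_less_b[of i] by (simp add: c_def)
  have E: "E \<ge> 0" by (simp add: E_def dform_nonneg)
  define g where "g i x = c i * h$i * line_energy v i x" for i x
  have g: "g i x \<ge> 0" for i x
    using c[of i] by (simp add: g_def line_energy_nonneg)
  have "(\<Sum>x\<in>X. \<Prod>i\<in>UNIV. ((v x)\<^sup>2 / s i x) powr r) \<le> (\<Sum>x\<in>X. \<Prod>i\<in>UNIV. g i x powr r)"
  proof (intro sum_mono prod_mono conjI powr_mono2)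
    fix x i assume x: "x \<in> X"
    show "0 \<le> (v x)\<^sup>2 / s i x" using s_pos[OF x, of i] by simp
    show "(v x)\<^sup>2 / s i x \<le> g i x" using square_div_s_le[of v x i, OF v x] by (simp add: g_def c_def)
  qed (use r in auto)
  also have "\<dots> \<le> (\<Prod>i\<in>UNIV. (\<Sum>x\<in>lines i. g i x) powr r)"
    unfolding grid_interior_slab[of a] r_def
    by (rule Loomis_Whitney) (auto simp: n2 g, simp add: g_def line_energy_upd)
  also have "\<dots> \<le> (\<Prod>i\<in>UNIV. (c i * h$i * E) powr r)"
  proof (intro prod_mono conjI powr_mono2)
    fix i
    have "(\<Sum>y\<in>lines i. line_energy v i y) \<le> E"
      unfolding E_def dform_line_energy
      by (rule member_le_sum) (auto simp: sum_nonneg line_energy_nonneg)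
    then have "c i * h$i * (\<Sum>y\<in>lines i. line_energy v i y) \<le> c i * h$i * E"
      using c[of i] by (intro mult_left_mono) auto
    then show "(\<Sum>x\<in>lines i. g i x) \<le> c i * h$i * E"
      by (simp add: g_def sum_distrib_left)
  qed (use r g in \<open>auto intro: sum_nonneg\<close>)
  also have "\<dots> = (\<Prod>i\<in>UNIV. c i) powr r * w powr r * (\<Prod>i\<in>(UNIV::'n set). E powr r)"
    using c E less_imp_le[OF c] by (simp add: powr_mult prod.distrib w_def prod_powr_distrib)
  also have "(\<Prod>i\<in>(UNIV::'n set). E powr r) = E powr (n * r)"
    using E r by (cases "E = 0") (auto simp: n_def powr_power mult.commute)
  finally have "w * (\<Sum>x\<in>X. \<Prod>i\<in>UNIV. ((v x)\<^sup>2 / s i x) powr r)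
     \<le> w * ((\<Prod>i\<in>UNIV. c i) powr r * w powr r * E powr (n * r))"
    using w_pos by simp
  \<comment> \<open>The factors \<open>h$i\<close> multiplied to \<open>w powr r\<close>. Since
    \<open>1 + r = n * r\<close>, the outer \<open>w\<close> completes this to the power that the
    energy carries, and the constant is free of the mesh.\<close>
  also have "\<dots> = (\<Prod>i\<in>UNIV. c i) powr r * ((w powr 1 * w powr r) * E powr (n * r))"
    using w_pos by simp
  also have "\<dots> = (\<Prod>i\<in>UNIV. c i) powr r * (w * E) powr (n * r)"
    unfolding powr_add[symmetric] r(2) using w_pos E by (simp add: powr_mult)
  finally show ?thesis by (simp add: c_def E_def)
qed

text \<open>Jacobi iteration: solved for the central value, the equation becomes a fixed point
  problem for a monotone map \<open>T\<close>. Its iterates from zero increase and stay below the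
  supersolution \<open>S\<close>, so they converge.\<close>

lemma Green_function_exists:
  assumes "x0 \<in> X"
  obtains G where "\<And>x. G x \<ge> 0" "\<And>x. x \<in> grid_boundary a b h \<Longrightarrow> G x = 0"
    "\<And>x. x \<in> X \<Longrightarrow> - discrete_laplacian h G x = (if x = x0 then 1 / w else 0)"
proof -
  define \<rho> where "\<rho> x = (if x = x0 then 1 / w else 0)" for x
  define D where "D = (\<Sum>i\<in>UNIV. 2 / (h$i)\<^sup>2)"
  define N where "N u x = (\<Sum>i\<in>UNIV. (u (x + h$i *\<^sub>R axis i 1) + u (x - h$i *\<^sub>R axis i 1)) / (h$i)\<^sup>2)"
    for u :: "real^'n \<Rightarrow> real" and x
  define T where "T u x = (if x \<in> X then (\<rho> x + N u x) / D else 0)" for u x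
  have D: "D > 0" unfolding D_def using h_pos by (intro sum_pos) auto
  have \<rho>: "0 \<le> \<rho> x" "\<rho> x \<le> 1 / w" for x using w_pos by (auto simp: \<rho>_def)
  have lap: "- discrete_laplacian h u x = D * u x - N u x" for u x
    unfolding discrete_laplacian_def D_def N_def sum_distrib_right sum_subtractf[symmetric] sum_negf[symmetric]
    by (intro sum.cong refl) (simp add: field_simps)
  have N_mono: "N u x \<le> N v x" if "x \<in> X" "\<And>y. y \<in> grid_closed a b h \<Longrightarrow> u y \<le> v y" for u v x
    unfolding N_def using that neighbour_closed[OF that(1)]
    by (intro sum_mono divide_right_mono add_mono) auto
  have T_mono: "T u x \<le> T v x" if "\<And>y. y \<in> grid_closed a b h \<Longrightarrow> u y \<le> v y" for u v x
    unfolding T_def using N_mono[OF _ that] D by (auto intro!: divide_right_mono)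
  obtain l :: 'n where True by blast
  \<comment> \<open>A parabola in one arbitrary coordinate: second differences of a quadratic are
    exact, so its negative Laplacian is the constant \<open>1 / w\<close>, which dominates the point
    source \<open>\<rho>\<close>.\<close>
  define S where "S x = (x$l - a$l) * (b$l - x$l) / (2 * w)" for x
  have S_nonneg: "S x \<ge> 0" if "x \<in> grid_closed a b h" for x
    using that w_pos by (auto simp: S_def grid_closed_def mem_box_cart)
  have "- discrete_laplacian h S x = 1 / w" for x
  proof -
    have "(S (x + h$i *\<^sub>R axis i 1) - 2 * S x + S (x - h$i *\<^sub>R axis i 1)) / (h$i)\<^sup>2
        = (if i = l then - 1 / w else 0)" for i
      using w_pos by (simp add: S_def axis_def field_simps power2_eq_square)
    then show ?thesis by (simp add: discrete_laplacian_def)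
  qed
  then have S_super: "T S x \<le> S x" if "x \<in> grid_closed a b h" for x
    using D \<rho>(2)[of x] S_nonneg[OF that] lap[of S x] by (auto simp: T_def field_simps)
  define U where "U j = (T ^^ j) (\<lambda>_. 0)" for j
  have U_Suc: "U (Suc j) = T (U j)" for j by (simp add: U_def)
  have U_0: "U 0 = (\<lambda>_. 0)" by (simp add: U_def)
  have inc: "U j x \<le> U (Suc j) x" for j x
  proof (induction j arbitrary: x)
    case 0
    have "0 \<le> T (\<lambda>_. 0) x" using \<rho>(1) D by (simp add: T_def N_def)
    then show ?case by (simp add: U_Suc U_0)
  next
    case (Suc j)
    show ?case unfolding U_Suc[of "Suc j"] U_Suc[of j]
      by (rule T_mono) (use Suc in \<open>simp add: U_Suc\<close>)
  qed
  have bound: "U j x \<le> S x" if "x \<in> grid_closed a b h" for j x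
    using that
  proof (induction j arbitrary: x)
    case 0
    then show ?case by (simp add: U_0 S_nonneg)
  next
    case (Suc j)
    have "U (Suc j) x \<le> T S x" unfolding U_Suc by (rule T_mono) (rule Suc.IH)
    then show ?case using S_super[OF Suc.prems] by linarith
  qed
  have "convergent (\<lambda>j. U j x)" for x
  proof (cases "x \<in> X")
    case True
    then have "U j x \<le> S x" for j using bound interior_closed by blast
    moreover have "incseq (\<lambda>j. U j x)" using inc by (simp add: incseq_SucI)
    ultimately show ?thesis by (metis incseq_convergent convergentI)
  next
    case False
    then have "U j x = 0" for j by (cases j) (simp_all add: U_0 U_Suc T_def)
    then show ?thesis by (simp add: convergent_const)
  qed
  then obtain G where G: "(\<lambda>j. U j x) \<longlonglongrightarrow> G x" for x
    unfolding convergent_def by metis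
  have "(\<lambda>j. T (U j) x) \<longlonglongrightarrow> T G x" for x
    using D unfolding T_def N_def
    by (cases "x \<in> X") (auto intro!: tendsto_intros G)
  then have fix_G: "G x = T G x" for x
    using LIMSEQ_unique[OF LIMSEQ_Suc[OF G]] by (simp add: U_Suc)
  show ?thesis
  proof
    fix x
    have "U 0 x \<le> G x" using inc by (intro incseq_le[OF _ G]) (simp add: incseq_SucI)
    then show "G x \<ge> 0" by (simp add: U_0)
    show "G x = 0" if "x \<in> grid_boundary a b h"
      using fix_G[of x] that by (simp add: T_def boundary_iff)
    show "- discrete_laplacian h G x = (if x = x0 then 1 / w else 0)" if "x \<in> X"
      using fix_G[of x] that D unfolding lap T_def \<rho>_def[symmetric] by (simp add: field_simps)
  qed
qed

end

section \<open>A priori estimates\<close>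

context mesh
begin

text \<open>Testing the equation of \<open>G\<close> with the bounded function \<open>\<psi>\<close>
  leaves only the pole, where \<open>\<psi>\<close> is at most \<open>\<kappa> powr (- e)\<close>.
  This bounds the energy of the truncated power \<open>v\<close> independently of mesh and pole. The
  weighted Sobolev inequality for \<open>v\<close> then controls \<open>G\<close> on the set where
  it is at least \<open>\<kappa>\<close>.\<close>

lemma Green_function_level_bound:
  fixes G :: "real^'n \<Rightarrow> real" and e \<kappa> :: real
  defines "q \<equiv> real CARD('n) / (real CARD('n) - 1)" and "r \<equiv> 1 / (real CARD('n) - 1)"
  assumes n2: "CARD('n) \<ge> 2" and e: "0 < e" "e < 1" and \<kappa>: "0 < \<kappa>" and x0: "x0 \<in> X"
    and G_nonneg: "\<And>x. G x \<ge> 0" and G_boundary: "\<And>x. x \<in> grid_boundary a b h \<Longrightarrow> G x = 0"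
    and G_lap: "\<And>x. x \<in> X \<Longrightarrow> - discrete_laplacian h G x = (if x = x0 then 1 / w else 0)"
  shows "w * (\<Sum>x\<in>{x\<in>X. \<kappa> \<le> G x}. G x powr ((1 - e) * q) * phi x powr (- r))
     \<le> (1 - 2 powr (- ((1 - e) / 2))) powr (- (2 * q)) * (\<Prod>i\<in>UNIV. (b$i - a$i) / 2) powr r
        * (\<kappa> powr (- e) / e) powr q"
proof -
  define \<sigma> where "\<sigma> = (1 - e) / 2"
  define c where "c = 1 - 2 powr (- \<sigma>)"
  define v where "v x = (G x + \<kappa>) powr \<sigma> - \<kappa> powr \<sigma>" for x
  define \<psi> where "\<psi> x = \<kappa> powr (- e) - (G x + \<kappa>) powr (- e)" for x
  have \<sigma>: "\<sigma> > 0" using e by (simp add: \<sigma>_def)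
  have "2 powr (- \<sigma>) < (2::real) powr 0" using \<sigma> by (intro powr_less_mono) auto
  then have c: "c > 0" by (simp add: c_def)
  have q: "q > 0" "r > 0" "q = real CARD('n) * r" using n2 by (auto simp: q_def r_def)
  have v0: "v x = 0" if "x \<in> grid_boundary a b h" for x
    using G_boundary[OF that] by (simp add: v_def)
  have \<psi>0: "\<psi> x = 0" if "x \<in> grid_boundary a b h" for x
    using G_boundary[OF that] by (simp add: \<psi>_def)

  have "dform v v \<le> (\<Sum>i\<in>UNIV. \<Sum>y\<in>lines i. \<Sum>j<m i.
     ((\<psi> (pt y i (j+1)) - \<psi> (pt y i j)) * (G (pt y i (j+1)) - G (pt y i j)) / (h$i)\<^sup>2) / e)"
    unfolding dform_def
  proof (intro sum_mono)
    fix i y j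
    let ?E = "(\<psi> (pt y i (j+1)) - \<psi> (pt y i j)) * (G (pt y i (j+1)) - G (pt y i j))"
    have "(v (pt y i (j+1)) - v (pt y i j)) * (v (pt y i (j+1)) - v (pt y i j)) \<le> ?E / e"
      using truncation_increment_le[OF e \<kappa> G_nonneg[of "pt y i j"] G_nonneg[of "pt y i (j+1)"]]
      by (simp add: v_def \<psi>_def \<sigma>_def power2_eq_square mult.commute)
    then have "(v (pt y i (j+1)) - v (pt y i j)) * (v (pt y i (j+1)) - v (pt y i j)) / (h$i)\<^sup>2
       \<le> ?E / e / (h$i)\<^sup>2"
      by (rule divide_right_mono) simp
    also have "\<dots> = ?E / (h$i)\<^sup>2 / e"
      by (simp only: divide_divide_eq_left mult.commute)
    finally show "(v (pt y i (j+1)) - v (pt y i j)) * (v (pt y i (j+1)) - v (pt y i j)) / (h$i)\<^sup>2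
       \<le> ?E / (h$i)\<^sup>2 / e" .
  qed
  also have "\<dots> = dform G \<psi> / e"
    by (simp add: dform_def sum_divide_distrib)
  also have "dform G \<psi> = (\<Sum>x\<in>X. \<psi> x * (- discrete_laplacian h G x))"
    using summation_by_parts[of \<psi> G] \<psi>0 by simp
  also have "\<dots> = \<psi> x0 / w"
    using x0 by (simp add: G_lap if_distrib[of "\<lambda>t. _ * t"] sum.delta cong: sum.cong if_cong)
  finally have "w * dform v v \<le> \<psi> x0 / e"
    using w_pos e by (simp add: field_simps)
  also have "\<dots> \<le> \<kappa> powr (- e) / e"
    using e by (intro divide_right_mono) (auto simp: \<psi>_def)
  finally have energy: "(w * dform v v) powr q \<le> (\<kappa> powr (- e) / e) powr q"
    using q w_pos dform_nonneg[of v] by (intro powr_mono2) auto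

  have pointwise: "G x powr ((1 - e) * q) * phi x powr (- r)
      \<le> c powr (- (2 * q)) * (\<Prod>i\<in>UNIV. ((v x)\<^sup>2 / s i x) powr r)"
    if x: "x \<in> X" and G: "\<kappa> \<le> G x" for x
  proof -
    have le: "c * G x powr \<sigma> \<le> v x"
      unfolding c_def v_def by (rule powr_increment_ge[OF \<sigma> \<kappa> G])
    have Gx: "G x > 0" using G \<kappa> by simp
    then have pos: "0 < c * G x powr \<sigma>" using c by simp
    then have vx: "v x > 0" using le by linarith
    have "c powr (2 * q) * G x powr ((1 - e) * q) = (c * G x powr \<sigma>) powr (2 * q)"
      using c Gx by (simp add: powr_mult powr_powr \<sigma>_def)
    also have "\<dots> \<le> v x powr (2 * q)"
      using le pos q by (intro powr_mono2) auto
    finally have "G x powr ((1 - e) * q) \<le> c powr (- (2 * q)) * v x powr (2 * q)"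
      using c by (simp add: powr_minus field_simps)
    then have "G x powr ((1 - e) * q) * phi x powr (- r)
        \<le> c powr (- (2 * q)) * v x powr (2 * q) * phi x powr (- r)"
      by (intro mult_right_mono) auto
    also have "\<dots> = c powr (- (2 * q)) * (v x powr (2 * q) / phi x powr r)"
      by (simp add: powr_minus field_simps)
    \<comment> \<open>The sine factors multiply to \<open>phi x\<close>, and \<open>q\<close> is n
      times \<open>r\<close>.\<close>
    also have "v x powr (2 * q) / phi x powr r = (\<Prod>i\<in>UNIV. ((v x)\<^sup>2 / s i x) powr r)"
    proof -
      have s0: "0 \<le> s i x" for i using s_pos[OF x, of i] by simp
      have "(\<Prod>i\<in>UNIV. ((v x)\<^sup>2 / s i x) powr r) = (\<Prod>i\<in>UNIV. ((v x)\<^sup>2) powr r / s i x powr r)"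
        using s0 by (intro prod.cong refl) (simp add: powr_divide)
      also have "\<dots> = (((v x)\<^sup>2) powr r) ^ CARD('n) / phi x powr r"
        using s0 by (simp add: prod_dividef phi_def prod_powr_distrib)
      also have "(((v x)\<^sup>2) powr r) ^ CARD('n) = v x powr (2 * q)"
        using vx by (simp add: powr_power powr_powr q(3) mult_ac flip: powr_numeral)
      finally show ?thesis by simp
    qed
    finally show ?thesis .
  qed
  have "(\<Sum>x\<in>{x\<in>X. \<kappa> \<le> G x}. G x powr ((1 - e) * q) * phi x powr (- r))
      \<le> (\<Sum>x\<in>{x\<in>X. \<kappa> \<le> G x}. c powr (- (2 * q)) * (\<Prod>i\<in>UNIV. ((v x)\<^sup>2 / s i x) powr r))"
    by (intro sum_mono pointwise) auto
  also have "\<dots> \<le> (\<Sum>x\<in>X. c powr (- (2 * q)) * (\<Prod>i\<in>UNIV. ((v x)\<^sup>2 / s i x) powr r))"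
    by (intro sum_mono2) (auto intro!: mult_nonneg_nonneg prod_nonneg)
  also have "\<dots> = c powr (- (2 * q)) * (\<Sum>x\<in>X. \<Prod>i\<in>UNIV. ((v x)\<^sup>2 / s i x) powr r)"
    by (simp only: sum_distrib_left)
  finally have "w * (\<Sum>x\<in>{x\<in>X. \<kappa> \<le> G x}. G x powr ((1 - e) * q) * phi x powr (- r))
      \<le> w * (c powr (- (2 * q)) * (\<Sum>x\<in>X. \<Prod>i\<in>UNIV. ((v x)\<^sup>2 / s i x) powr r))"
    using w_pos by (intro mult_left_mono) auto
  also have "\<dots> = c powr (- (2 * q)) * (w * (\<Sum>x\<in>X. \<Prod>i\<in>UNIV. ((v x)\<^sup>2 / s i x) powr r))"
    by simp
  also have "\<dots> \<le> c powr (- (2 * q)) *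
      ((\<Prod>i\<in>UNIV. (b$i - a$i) / 2) powr r * (w * dform v v) powr q)"
    using weighted_Sobolev[OF n2, of v] v0 by (intro mult_left_mono) (auto simp: q(3) r_def)
  also have "\<dots> \<le> c powr (- (2 * q)) *
      ((\<Prod>i\<in>UNIV. (b$i - a$i) / 2) powr r * (\<kappa> powr (- e) / e) powr q)"
    using energy by (intro mult_left_mono) auto
  finally show ?thesis by (simp add: c_def \<sigma>_def)
qed

text \<open>Testing with \<open>phi\<close> gives \<open>eig * U\<close> for the sum of
  \<open>F * phi\<close>, while the lower bound on \<open>F\<close> makes it at least
  \<open>lam * U\<close> minus a constant times the number of nodes. The gap between
  \<open>lam\<close> and \<open>lambda1 a b\<close> bounds \<open>U\<close>, and hence the
  source.\<close>

lemma weighted_source_bound: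
  assumes u: "\<And>x. x \<in> grid_boundary a b h \<Longrightarrow> u x = 0" "\<And>x. x \<in> X \<Longrightarrow> u x \<ge> 0"
    and eq: "\<And>x. x \<in> X \<Longrightarrow> - discrete_laplacian h u x = F x"
    and F: "\<And>x. x \<in> X \<Longrightarrow> F x \<ge> lam * u x - C" and C: "C \<ge> 0" and lam: "lam > lambda1 a b"
  shows "w * (\<Sum>x\<in>X. F x * phi x) \<le> lambda1 a b * C * (\<Prod>i\<in>UNIV. b$i - a$i) / (lam - lambda1 a b)"
proof -
  define U where "U = (\<Sum>x\<in>X. u x * phi x)"
  have U: "U \<ge> 0" unfolding U_def by (intro sum_nonneg mult_nonneg_nonneg u less_imp_le[OF phi_pos])
  have l1: "lambda1 a b \<ge> 0" unfolding lambda1_def by (intro sum_nonneg) simp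
  have "(\<Sum>x\<in>X. F x * phi x) = (\<Sum>x\<in>X. phi x * (- discrete_laplacian h u x))"
    by (intro sum.cong refl) (simp add: eq)
  also have "\<dots> = (\<Sum>x\<in>X. u x * (- discrete_laplacian h phi x))"
    by (rule Green_identity) (simp_all add: u phi_boundary)
  also have "\<dots> = eig * U"
    by (simp only: phi_eigenfunction U_def sum_distrib_left mult_ac)
  finally have FU: "(\<Sum>x\<in>X. F x * phi x) \<le> lambda1 a b * U"
    using eig_le U by (simp add: mult_right_mono)
  have "lam * U - C * real (card X) \<le> (\<Sum>x\<in>X. (lam * u x - C) * phi x)"
  proof -
    have "(\<Sum>x\<in>X. C * phi x) \<le> (\<Sum>x\<in>X. C * 1)"
      using C phi_le_1 by (intro sum_mono mult_left_mono) auto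
    also have "(\<Sum>x\<in>X. C * 1) = C * real (card X)" by simp
    finally have "(\<Sum>x\<in>X. C * phi x) \<le> C * real (card X)" .
    moreover have "(\<Sum>x\<in>X. (lam * u x - C) * phi x) = lam * U - (\<Sum>x\<in>X. C * phi x)"
      by (simp only: U_def left_diff_distrib sum_subtractf sum_distrib_left mult.assoc)
    ultimately show ?thesis by linarith
  qed
  also have "\<dots> \<le> (\<Sum>x\<in>X. F x * phi x)"
    using F phi_pos by (intro sum_mono mult_right_mono) (auto intro: less_imp_le)
  finally have "(lam - lambda1 a b) * U \<le> C * real (card X)"
    using FU by (simp add: left_diff_distrib)
  then have "U \<le> C * real (card X) / (lam - lambda1 a b)"
    using lam by (simp add: field_simps)
  then have "w * (\<Sum>x\<in>X. F x * phi x) \<le> w * (lambda1 a b * (C * real (card X) / (lam - lambda1 a b)))"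
    using w_pos by (intro mult_left_mono order_trans[OF FU] mult_left_mono l1) auto
  also have "\<dots> = lambda1 a b * C * (w * real (card X)) / (lam - lambda1 a b)"
    by simp
  also have "\<dots> \<le> lambda1 a b * C * (\<Prod>i\<in>UNIV. b$i - a$i) / (lam - lambda1 a b)"
    using volume_le lam l1 C by (intro divide_right_mono mult_left_mono) auto
  finally show ?thesis .
qed

text \<open>The solution at a point is \<open>w \<Sum> G F\<close>. Where \<open>G < 1 / S\<close>, the product \<open>G F\<close> is at most \<open>1\<close>.
  Elsewhere \<open>G\<close> is split at the level \<open>T \<phi>\<close>: the part below is controlled by the weighted
  bound on \<open>F\<close>, and above one has \<open>G \<le> G (G / (T \<phi>))\<^sup>\<mu>\<close>, which the level bound controls.\<close>

lemma solution_bound: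
  fixes F u :: "real^'n \<Rightarrow> real" and e S K :: real
  defines "q \<equiv> real CARD('n) / (real CARD('n) - 1)" and "r \<equiv> 1 / (real CARD('n) - 1)"
  assumes n2: "CARD('n) \<ge> 2" and e: "0 < e" "e \<le> 1 / real CARD('n)"
    and u: "\<And>x. x \<in> grid_boundary a b h \<Longrightarrow> u x = 0"
    and eq: "\<And>x. x \<in> X \<Longrightarrow> - discrete_laplacian h u x = F x"
    and F: "\<And>x. x \<in> X \<Longrightarrow> 0 \<le> F x" "\<And>x. x \<in> X \<Longrightarrow> F x \<le> S" and S: "S \<ge> 1"
    and K: "w * (\<Sum>x\<in>X. F x * phi x) \<le> K" and x0: "x0 \<in> X"
  shows "u x0 \<le> (\<Prod>i\<in>UNIV. b$i - a$i) + (K + (1 - 2 powr (- ((1 - e) / 2))) powr (- (2 * q))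
        * (\<Prod>i\<in>UNIV. (b$i - a$i) / 2) powr r * (1 / e) powr q) * S powr (1 / q + 3 * e)"
proof -
  define B where "B = (1 - 2 powr (- ((1 - e) / 2))) powr (- (2 * q)) * (\<Prod>i\<in>UNIV. (b$i - a$i) / 2) powr r"
  have n: "real CARD('n) \<ge> 2" using n2 by simp
  have q: "q > 1" "q \<le> 2" "r > 0" "q = 1 + r" using n by (auto simp: q_def r_def field_simps)
  have "1 / real CARD('n) \<le> 1 / 2" using n by (intro divide_left_mono) auto
  then have e1: "e < 1" using e by linarith
  \<comment> \<open>Chosen so that \<open>1 + \<mu>\<close> is the exponent of the level bound. The
    restriction on \<open>e\<close> gives \<open>\<mu> \<ge> 0\<close>, and
    \<open>\<mu> \<le> r\<close> allows replacing \<open>phi x powr (- \<mu>)\<close> by the weight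
    \<open>phi x powr (- r)\<close>.\<close>
  define \<mu> where "\<mu> = (1 - e) * q - 1"
  have "1 / real CARD('n) * q = r" using n by (simp add: q_def r_def)
  then have "e * q \<le> r" using e q by (metis mult_right_mono less_imp_le less_trans zero_less_one)
  then have \<mu>: "0 \<le> \<mu>" "\<mu> \<le> r" using e q by (auto simp: \<mu>_def algebra_simps)
  define \<kappa> where "\<kappa> = 1 / S"
  \<comment> \<open>Up to errors of order \<open>e\<close> in the exponent, this balances the low
    part, of size \<open>T\<close>, with the high part, of size \<open>S * T powr (- \<mu>)\<close>,
    because \<open>\<mu>\<close> is close to \<open>q - 1\<close>.\<close>
  define T where "T = S powr (1 / q)"
  have \<kappa>: "\<kappa> > 0" and T: "T > 0" using S by (auto simp: \<kappa>_def T_def)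
  obtain G where G: "\<And>x. G x \<ge> 0" "\<And>x. x \<in> grid_boundary a b h \<Longrightarrow> G x = 0"
    "\<And>x. x \<in> X \<Longrightarrow> - discrete_laplacian h G x = (if x = x0 then 1 / w else 0)"
    using Green_function_exists[OF x0] by blast
  define g where "g x = (if \<kappa> \<le> G x then G x powr ((1 - e) * q) * phi x powr (- r) else 0)" for x
  \<comment> \<open>Green's representation: the Laplacian of \<open>G\<close> is a point mass at
    \<open>x0\<close>, and Green's identity moves it onto \<open>u\<close>.\<close>
  have "u x0 = w * (\<Sum>x\<in>X. u x * (- discrete_laplacian h G x))"
    using x0 w_pos by (simp add: G(3) if_distrib[of "\<lambda>t. _ * t"] sum.delta cong: sum.cong if_cong)
  also have "(\<Sum>x\<in>X. u x * (- discrete_laplacian h G x)) = (\<Sum>x\<in>X. G x * (- discrete_laplacian h u x))"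
    by (rule Green_identity) (simp_all add: u G)
  also have "\<dots> = (\<Sum>x\<in>X. G x * F x)"
    by (intro sum.cong refl) (simp add: eq)
  also have "\<dots> \<le> (\<Sum>x\<in>X. 1 + T * (F x * phi x) + S * T powr (- \<mu>) * g x)"
  proof (rule sum_mono)
    fix x assume x: "x \<in> X"
    have phi: "0 < phi x" "phi x \<le> 1" using phi_pos phi_le_1 x by auto
    have Fx: "0 \<le> F x" "F x \<le> S" using F x by auto
    have nn: "0 \<le> T * (F x * phi x)" "0 \<le> S * T powr (- \<mu>) * g x"
      using T Fx phi S by (auto simp: g_def)
    consider "G x < \<kappa>" | "\<kappa> \<le> G x" "G x \<le> T * phi x" | "\<kappa> \<le> G x" "T * phi x < G x"
      by linarith
    then show "G x * F x \<le> 1 + T * (F x * phi x) + S * T powr (- \<mu>) * g x"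
    proof cases
      case 1
      have "G x * F x \<le> \<kappa> * S" using 1 Fx G(1)[of x] by (intro mult_mono) auto
      then show ?thesis using nn S by (simp add: \<kappa>_def)
    next
      case 2
      have "G x * F x \<le> T * phi x * F x" using 2 Fx by (intro mult_right_mono)
      then show ?thesis using nn by (simp add: mult_ac)
    next
      case 3
      have Gx: "G x > 0" using 3 \<kappa> by linarith
      have "1 \<le> (G x / (T * phi x)) powr \<mu>"
        using 3 \<mu> T phi by (intro ge_one_powr_ge_zero) (auto simp: field_simps)
      then have "G x \<le> G x * (G x / (T * phi x)) powr \<mu>" using Gx by simp
      also have "\<dots> = T powr (- \<mu>) * (G x powr (1 + \<mu>) * phi x powr (- \<mu>))"
        using Gx T phi by (simp add: powr_divide powr_mult powr_add powr_minus field_simps)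
      also have "\<dots> \<le> T powr (- \<mu>) * (G x powr (1 + \<mu>) * phi x powr (- r))"
        using phi \<mu> by (intro mult_left_mono powr_mono') auto
      also have "\<dots> = T powr (- \<mu>) * g x" using 3 by (simp add: g_def \<mu>_def)
      finally have "G x * F x \<le> T powr (- \<mu>) * g x * S"
        using Fx Gx by (intro mult_mono) auto
      then show ?thesis using nn by (simp add: mult_ac)
    qed
  qed
  also have "\<dots> = real (card X) + T * (\<Sum>x\<in>X. F x * phi x) + S * T powr (- \<mu>) * (\<Sum>x\<in>X. g x)"
    by (simp add: sum.distrib sum_distrib_left)
  also have "(\<Sum>x\<in>X. g x) = (\<Sum>x\<in>{x\<in>X. \<kappa> \<le> G x}. G x powr ((1 - e) * q) * phi x powr (- r))"
    unfolding g_def by (rule sum.inter_filter[symmetric]) simp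
  finally have "u x0 \<le> w * real (card X) + T * (w * (\<Sum>x\<in>X. F x * phi x)) + S * T powr (- \<mu>) *
      (w * (\<Sum>x\<in>{x\<in>X. \<kappa> \<le> G x}. G x powr ((1 - e) * q) * phi x powr (- r)))"
    using w_pos by (simp add: algebra_simps)
  also have "\<dots> \<le> (\<Prod>i\<in>UNIV. b$i - a$i) + T * K + S * T powr (- \<mu>) * (B * (\<kappa> powr (- e) / e) powr q)"
    unfolding B_def using Green_function_level_bound[OF n2 e(1) e1 \<kappa> x0 G] T S K volume_le
    by (intro add_mono mult_left_mono) (auto simp: q_def r_def)
  also have "S * T powr (- \<mu>) * (B * (\<kappa> powr (- e) / e) powr q)
      = B * (1 / e) powr q * (S powr 1 * S powr (- \<mu> / q) * S powr (e * q))"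
    using S e by (simp add: T_def \<kappa>_def powr_powr powr_divide powr_minus field_simps)
  also have "S powr 1 * S powr (- \<mu> / q) * S powr (e * q) = S powr (1 / q + e + e * q)"
    unfolding powr_add[symmetric] using q by (simp add: \<mu>_def field_simps)
  finally have *: "u x0 \<le> (\<Prod>i\<in>UNIV. b$i - a$i) + T * K
      + B * (1 / e) powr q * S powr (1 / q + e + e * q)" .
  have "0 \<le> w * (\<Sum>x\<in>X. F x * phi x)"
    using w_pos F(1) phi_pos by (intro mult_nonneg_nonneg sum_nonneg) (auto intro: less_imp_le)
  then have "T * K \<le> S powr (1 / q + 3 * e) * K"
    unfolding T_def using S e K by (intro mult_right_mono powr_mono) auto
  \<comment> \<open>The dimension is at least two, so \<open>q \<le> 2\<close>; this is where
    \<open>3 * e\<close> in the exponent comes from.\<close>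
  moreover have "e * q \<le> e * 2" using e q by (intro mult_left_mono) auto
  then have "B * (1 / e) powr q * S powr (1 / q + e + e * q)
      \<le> B * (1 / e) powr q * S powr (1 / q + 3 * e)"
    using S by (intro mult_left_mono powr_mono) (auto simp: B_def)
  ultimately have "u x0 \<le> (\<Prod>i\<in>UNIV. b$i - a$i) + (K + B * (1 / e) powr q) * S powr (1 / q + 3 * e)"
    using * by (simp add: algebra_simps)
  then show ?thesis by (simp only: B_def)
qed

end

section \<open>Uniform bound\<close>

lemma admissible_mesh_imp_mesh:
  fixes a b h :: "real^'n"
  assumes "admissible_mesh a b h"
  obtains k m where "mesh a b h k m"
proof -
  obtain k l :: "'n \<Rightarrow> int" where *: "\<And>i. h$i > 0" "\<And>i. a$i = of_int (k i) * h$i"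
    "\<And>i. b$i = of_int (l i) * h$i" "\<And>i. l i - k i > 1"
    using assms unfolding admissible_mesh_def by metis
  have "mesh a b h k (\<lambda>i. nat (l i - k i))"
  proof
    fix i
    have "real (nat (l i - k i)) = of_int (l i) - of_int (k i)"
      using *(4)[of i] by simp
    then show "b$i = a$i + real (nat (l i - k i)) * h$i"
      using *(2,3)[of i] by (simp add: algebra_simps)
    show "2 \<le> nat (l i - k i)" using *(4)[of i] by simp
  qed (use * in auto)
  then show ?thesis by (rule that)
qed

theorem mainTheorem2:
  fixes a b :: "real^'n" and f :: "real^'n \<Rightarrow> real \<Rightarrow> real"
    and C1 C2 C3 lam p :: real
  assumes n2: "CARD('n) \<ge> 2"
    and ab: "\<forall>i. a$i < b$i"
    and C_pos: "C1 > 0" "C2 > 0" "C3 > 0"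
    and f_nonneg: "\<forall>x\<in>box a b. \<forall>s\<ge>0. f x s \<ge> 0"
    and lam_gt: "lam > lambda1 a b"
    and f_lower: "\<forall>x\<in>box a b. \<forall>s\<ge>0. f x s \<ge> lam * s - C1"
    and p_range: "1 < p" "p < real CARD('n) / (real CARD('n) - 1)"
    and f_upper: "\<forall>x\<in>box a b. \<forall>s\<ge>0. f x s \<le> C2 * s powr p + C3"
  shows "\<exists>M. \<forall>h u. admissible_mesh a b h \<longrightarrow>
            (\<forall>x\<in>grid_closed a b h. u x \<ge> 0) \<longrightarrow>
            (\<forall>x\<in>grid_interior a b h. - discrete_laplacian h u x = f x (u x)) \<longrightarrow>
            (\<forall>x\<in>grid_boundary a b h. u x = 0) \<longrightarrow>
            (\<forall>x\<in>grid_closed a b h. \<bar>u x\<bar> \<le> M)"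
proof -
  define q where "q = real CARD('n) / (real CARD('n) - 1)"
  \<comment> \<open>The first bound is what \<open>solution_bound\<close> asks for. The second puts
    \<open>\<alpha>\<close> at or below the midpoint of \<open>1 / q\<close> and
    \<open>1 / p\<close>, so that \<open>p * \<alpha> < 1\<close>.\<close>
  define e where "e = min (1 / real CARD('n)) ((1 / p - 1 / q) / 6)"
  define \<alpha> where "\<alpha> = 1 / q + 3 * e"
  define V where "V = (\<Prod>i\<in>UNIV. b$i - a$i)"
  define K where "K = lambda1 a b * C1 * V / (lam - lambda1 a b)"
  define B where "B = K + (1 - 2 powr (- ((1 - e) / 2))) powr (- (2 * q))
        * (\<Prod>i\<in>UNIV. (b$i - a$i) / 2) powr (1 / (real CARD('n) - 1)) * (1 / e) powr q"
  \<comment> \<open>The bound of \<open>sublinear_bound\<close>, with all constants fixed before a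
    mesh is chosen.\<close>
  define M where "M = max 1 ((V + B * (C2 + (C3 + 1)) powr \<alpha>) powr (1 / (1 - p * \<alpha>)))"
  have n: "real CARD('n) \<ge> 2" using n2 by simp
  have q: "q > 0" using n by (simp add: q_def)
  have p: "p > 0" "p < q" using p_range by (auto simp: q_def)
  have gap: "1 / q < 1 / p" using p by (intro divide_strict_left_mono) auto
  have "0 < e" using gap n by (simp add: e_def)
  moreover have "e \<le> 1 / real CARD('n)" "e \<le> (1 / p - 1 / q) / 6"
    unfolding e_def by (rule min.cobounded1, rule min.cobounded2)
  ultimately have e: "0 < e" "e \<le> 1 / real CARD('n)" "e \<le> (1 / p - 1 / q) / 6" .
  have \<alpha>: "0 < \<alpha>" using q e by (simp add: \<alpha>_def add_pos_pos)
  have "y + 3 * e < x" if "e \<le> (x - y) / 6" "y < x" for x y :: real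
    using that by (simp add: field_simps)
  from this[OF e(3) gap] have "\<alpha> < 1 / p" by (simp only: \<alpha>_def)
  then have p\<alpha>: "p * \<alpha> < 1" using p by (simp add: field_simps)
  have V: "V \<ge> 0" unfolding V_def using ab by (intro prod_nonneg) (auto intro: less_imp_le)
  have "lambda1 a b \<ge> 0" unfolding lambda1_def by (intro sum_nonneg) simp
  then have "K \<ge> 0" using V C_pos lam_gt by (simp add: K_def)
  then have B: "B \<ge> 0" by (simp add: B_def)
  have "\<bar>u x\<bar> \<le> M"
    if adm: "admissible_mesh a b h" and u_nonneg: "\<forall>x\<in>grid_closed a b h. u x \<ge> 0"
      and eq: "\<forall>x\<in>grid_interior a b h. - discrete_laplacian h u x = f x (u x)"
      and u_boundary: "\<forall>x\<in>grid_boundary a b h. u x = 0"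
      and x: "x \<in> grid_closed a b h"
    for h u x
  proof (cases "x \<in> grid_interior a b h")
    case False
    then have "x \<in> grid_boundary a b h"
      using x by (auto simp: grid_boundary_def grid_interior_def grid_closed_def)
    then show ?thesis using u_boundary by (simp add: M_def)
  next
    case True
    obtain k m where "mesh a b h k m" using admissible_mesh_imp_mesh[OF adm] .
    then interpret mesh a b h k m .
    have un: "u y \<ge> 0" if "y \<in> X" for y using u_nonneg interior_closed that by blast
    have box: "y \<in> box a b" if "y \<in> X" for y using that by (simp add: grid_interior_def)
    have "Max (u ` X) \<in> u ` X" using finite_X True by (intro Max_in) auto
    then obtain x0 where x0: "x0 \<in> X" "u x0 = Max (u ` X)" by force
    then have max: "u y \<le> u x0" if "y \<in> X" for y using finite_X that by simp
    have u0: "u x0 \<ge> 0" by (rule un[OF x0(1)])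
    \<comment> \<open>This bounds the source on all of \<open>X\<close> because \<open>x0\<close>
      maximises \<open>u\<close> there; the added one ensures \<open>S \<ge> 1\<close>.\<close>
    define S where "S = C2 * u x0 powr p + (C3 + 1)"
    have S: "S \<ge> 1" using C_pos u0 by (simp add: S_def)
    have "w * (\<Sum>y\<in>X. f y (u y) * phi y) \<le> K"
      unfolding K_def V_def
      using u_boundary un eq f_lower box C_pos lam_gt by (intro weighted_source_bound[where u = u]) auto
    moreover have "f y (u y) \<le> S" if y: "y \<in> X" for y
    proof -
      have "f y (u y) \<le> C2 * u y powr p + C3" using f_upper box[OF y] un[OF y] by blast
      moreover have "C2 * u y powr p \<le> C2 * u x0 powr p"
        using C_pos p un[OF y] max[OF y] by (intro mult_left_mono powr_mono2) auto
      ultimately show ?thesis by (simp add: S_def)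
    qed
    ultimately have "u x0 \<le> V + B * S powr \<alpha>"
      unfolding V_def B_def \<alpha>_def q_def
      using n2 e(1,2) u_boundary eq f_nonneg box un S x0(1)
      by (intro solution_bound[where u = u and F = "\<lambda>y. f y (u y)"]) auto
    \<comment> \<open>As \<open>S\<close> grows like the power \<open>p\<close> of
      \<open>u x0\<close>, the previous estimate is a sublinear inequality for the maximum.\<close>
    then have "u x0 \<le> M"
      unfolding M_def S_def
      using V B C_pos p \<alpha> p\<alpha> u0 by (intro sublinear_bound) auto
    then show ?thesis using max[OF True] un[OF True] by simp
  qed
  then show ?thesis by blast
qed

end
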